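(* Consider the parametric optimal control problem described in the context, with data $d$ and local primal-dual solution $w^\star$, and let $\mathcal{LQP}$ be the associated linear-quadratic problem, with an arbitrary perturbation direction $l=(l_{-1},l_0,\dots,l_N)$. Suppose there is a constant $\gamma_H>0$ such that the reduced Hessian at $(w^\star;d)$ satisfies $ReH(w^\star;d)\succeq\gamma_H I$ (uniform SOSC: $\gamma_H$ is independent of $N$). Execute the convexification procedure with $\beta\in(0,\gamma_H)$, producing $\{\tilde H_k,\tilde D_k\}_{k=0}^N$ and $\{\bar Q_k\}_{k=0}^N$, and let $\mathcal{CLQP}$ be the resulting convexified problem. Let $(p^\star,q^\star,\zeta^\star)$ and $(p^{c\star},q^{c\star},\zeta^{c\star})$ be the primal-dual solutions of $\mathcal{LQP}$ and $\mathcal{CLQP}$, respectively. Then $$p^\star=p^{c\star},\qquad q^\star=q^{c\star},\qquad \zeta^\star=\zeta^{c\star}-2\bar Q\,p^\star,$$ where $\bar Q=\mathrm{diag}(\bar Q_0,\dots,\bar Q_N)$, $p^\star=(p_0^\star;\dots;p_N^\star)$ and $\zeta^\star=(\zeta^\star_{-1};\dots;\zeta^\star_{N-1})$; that is, $\zeta_k^\star=\zeta_k^{c\star}-2\bar Q_{k+1}p^\star_{k+1}$ for all $k\in\{-1,\dots,N-1\}$.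
   Context: **Parametric optimal control problem.** Let $N\ge 1$ and let $[n]=\{0,\dots,n\}$. Given data $d=(d_{-1},d_0,\dots,d_N)$ with $d_{-1}=\bar x_0\in\mathbb{R}^{n_x}$ and $d_k\in\mathbb{R}^{n_d}$ for $k\in[N]$, consider $$\min_{\{x_k\},\{u_k\}}\ \sum_{k=0}^{N-1}g_k(x_k,u_k;d_k)+g_N(x_N;d_N)\quad\text{s.t. } x_{k+1}=f_k(x_k,u_k;d_k)\ (\lambda_k),\ k\in[N-1],\quad x_0=\bar x_0\ (\lambda_{-1}),$$ with $x_k\in\mathbb{R}^{n_x}$, $u_k\in\mathbb{R}^{n_u}$, multipliers $\lambda_k\in\mathbb{R}^{n_x}$, and $f_k,g_k$ twice continuously differentiable. Write $z_k=(x_k;u_k)$, $z_N=x_N$, $w=(x,u,\lambda)$. The Lagrangian is $\sum_{k=0}^{N}\mathcal L_k-\lambda_{-1}^Td_{-1}$ with $\mathcal L_k=g_k(z_k;d_k)+\lambda_{k-1}^Tx_k-\lambda_k^Tf_k(z_k;d_k)$ for $k\in[N-1]$ and $\mathcal L_N=g_N(x_N;d_N)+\lambda_{N-1}^Tx_N$. Let $w^\star$ be a local minimizer with its multipliers (local primal-dual solution). **Matrices** (all evaluated at $(w^\star;d)$). For $k\in[N-1]$: $A_k=\partial f_k/\partial x_k$, $B_k=\partial f_k/\partial u_k$, $C_k=\partial f_k/\partial d_k$ (Jacobians); $H_k=\begin{pmatrix} Q_k & S_k^T \\ S_k & R_k \end{pmatrix}=\nabla^2_{z_k}\mathcal L_k$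 (blocks $Q_k=\nabla^2_{x_k}\mathcal L_k$, $S_k=\nabla^2_{u_kx_k}\mathcal L_k$, $R_k=\nabla^2_{u_k}\mathcal L_k$); $D_k=(D_{k1}\ D_{k2})=(\nabla^2_{d_kx_k}\mathcal L_k\ \ \nabla^2_{d_ku_k}\mathcal L_k)$. Also $H_N=Q_N=\nabla^2_{x_N}\mathcal L_N$, $D_N=\nabla^2_{d_Nx_N}\mathcal L_N$. **Reduced Hessian.** $H=\mathrm{diag}(H_0,\dots,H_N)$; $G$ is the Jacobian of the constraints with respect to $z=(z_0;\dots;z_N)$: its first block row is $z\mapsto x_0$, and the block row for stage $k\in[N-1]$ is $z\mapsto x_{k+1}-A_kx_k-B_ku_k$. $Z$ is a matrix whose columns form an orthonormal basis of $\ker G$; $ReH=Z^THZ$. **Problem $\mathcal{LQP}$.** For a direction $l=(l_{-1},l_0,\dots,l_N)$: $$\min_{\{p_k\},\{q_k\}}\ \sum_{k=0}^{N-1}\begin{pmatrix} p_k \\ q_k \\ l_k \end{pmatrix}^T\begin{pmatrix} Q_k & S_k^T & D_{k1}^T \\ S_k & R_k & D_{k2}^T \\ D_{k1} & D_{k2} & 0 \end{pmatrix}\begin{pmatrix} p_k \\ q_k \\ l_k \end{pmatrix}+\begin{pmatrix} p_N \\ l_N \end{pmatrix}^T\begin{pmatrix} Q_N & D_N^T \\ D_N & 0 \end{pmatrix}\begin{pmatrix} p_N \\ l_N \end{pmatrix}$$ $$\text{s.t. } p_{k+1}=A_kp_k+B_kq_k+C_kl_k\ (\zeta_k),\ k\in[N-1],\qquad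 p_0=l_{-1}\ (\zeta_{-1}).$$ Sign convention for multipliers: the Lagrangian is (objective) $+\sum_{k=0}^{N-1}\zeta_k^T(p_{k+1}-A_kp_k-B_kq_k-C_kl_k)+\zeta_{-1}^T(p_0-l_{-1})$. When $ReH\succ0$, $\mathcal{LQP}$ has a unique (global) primal-dual solution. **Convexification procedure** with parameter $\beta>0$. Set $\tilde H_N=\tilde Q_N=\beta I$, $\bar Q_N=Q_N-\tilde Q_N$, $\tilde D_N=D_N$. For $k=N-1,\dots,0$: set $$\begin{pmatrix} \hat Q_k & \tilde S_k^T & \tilde D_{k1}^T \\ \tilde S_k & \tilde R_k & \tilde D_{k2}^T \\ \tilde D_{k1} & \tilde D_{k2} & * \end{pmatrix}=\begin{pmatrix} Q_k & S_k^T & D_{k1}^T \\ S_k & R_k & D_{k2}^T \\ D_{k1} & D_{k2} & 0 \end{pmatrix}+\begin{pmatrix} A_k^T \\ B_k^T \\ C_k^T \end{pmatrix}\bar Q_{k+1}\begin{pmatrix} A_k & B_k & C_k \end{pmatrix}$$ (the block $*$ is discarded), $\tilde Q_k=\tilde S_k^T\tilde R_k^{-1}\tilde S_k+\beta I$, $\tilde H_k=\begin{pmatrix} \tilde Q_k & \tilde S_k^T \\ \tilde S_k & \tilde R_k \end{pmatrix}$, $\tilde D_k=(\tilde D_{k1}\ \tilde D_{k2})$, $\bar Q_k=\hat Q_k-\tilde Q_k$. (When $ReH\succeq\gamma_HI$ and $\beta\in(0,\gamma_H)$, it is known that all $\tilde H_k\succ0$, so the procedure is well defined.) **Problem $\mathcal{CLQP}$**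 is $\mathcal{LQP}$ with $\{H_k,D_k\}$ replaced by $\{\tilde H_k,\tilde D_k\}$ (constraints, $l$ and sign convention unchanged). *)

theory Defs
  imports "HOL-Analysis.Analysis"
begin

section \<open>Gradients, Hessians and twice continuous differentiability\<close>

definition C2 :: "('a::real_normed_vector \<Rightarrow> 'b::real_normed_vector) \<Rightarrow> bool" where
  "C2 f \<longleftrightarrow> (\<exists>(f' :: 'a \<Rightarrow> 'a \<Rightarrow>\<^sub>L 'b) (f'' :: 'a \<Rightarrow> 'a \<Rightarrow>\<^sub>L 'a \<Rightarrow>\<^sub>L 'b).
     (\<forall>x. (f has_derivative blinfun_apply (f' x)) (at x)) \<and>
     (\<forall>x. (f' has_derivative blinfun_apply (f'' x)) (at x)) \<and>
     continuous_on UNIV f'')"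

definition gradient :: "(real^'n \<Rightarrow> real) \<Rightarrow> real^'n \<Rightarrow> real^'n" where
  "gradient f x = (THE D. GDERIV f x :> D)"

lemma gradient_eq:
  fixes f :: "real^'n \<Rightarrow> real"
  assumes "GDERIV f x :> D"
  shows "gradient f x = D"
  unfolding gradient_def
proof (rule the_equality)
  fix E assume "GDERIV f x :> E"
  with assms have "(\<lambda>h. h \<bullet> E) = (\<lambda>h. h \<bullet> D)"
    unfolding gderiv_def by (rule has_derivative_unique[rotated])
  then show "E = D"
    by (metis inner_commute vector_eq_rdot)
qed (fact assms)

definition hessian :: "(real^'n \<Rightarrow> real) \<Rightarrow> real^'n \<Rightarrow> real^'n^'n" where
  "hessian f x = jacobian (gradient f) (at x)"

text \<open>\<open>mixed_hessian F y x\<close> is the matrix of second partials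
  \<open>\<partial>\<^sup>2F/\<partial>y\<partial>x\<close> at \<open>(y, x)\<close>, with rows indexed by \<open>y\<close> and columns by \<open>x\<close>.\<close>

definition mixed_hessian ::
    "(real^'m \<Rightarrow> real^'n \<Rightarrow> real) \<Rightarrow> real^'m \<Rightarrow> real^'n \<Rightarrow> real^'n^'m" where
  "mixed_hessian F y x = jacobian (\<lambda>x'. gradient (\<lambda>y'. F y' x') y) (at x)"


section \<open>The parametric optimal control problem\<close>

text \<open>The state, control and data spaces are \<open>real^'x\<close>, \<open>real^'u\<close> and \<open>real^'d\<close>; the
  horizon \<open>N\<close> is an ordinary natural number. Stage-indexed quantities are functions on
  \<open>nat\<close>, meaningful only up to the horizon: for \<open>k \<le> N\<close> in the case of states, data and
  multipliers, and for \<open>k < N\<close> in the case of controls.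

  Indices that start at \<open>-1\<close> are shifted. The datum \<open>d\<^sub>-\<^sub>1\<close> (and the direction \<open>l\<^sub>-\<^sub>1\<close>)
  is a separate argument, and a multiplier sequence \<open>lam\<close> stores \<open>\<lambda>\<^sub>k\<^sub>-\<^sub>1\<close> at position \<open>k\<close>:
  \<open>lam 0\<close> belongs to the initial condition and \<open>lam (Suc k)\<close> to the dynamics of stage \<open>k\<close>.\<close>

record ('x::finite, 'u::finite, 'd::finite) ocp =
  dyn :: "nat \<Rightarrow> real^'x \<Rightarrow> real^'u \<Rightarrow> real^'d \<Rightarrow> real^'x"
  cost :: "nat \<Rightarrow> real^'x \<Rightarrow> real^'u \<Rightarrow> real^'d \<Rightarrow> real"
  term_cost :: "real^'x \<Rightarrow> real^'d \<Rightarrow> real"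

definition smooth_ocp :: "nat \<Rightarrow> ('x::finite,'u::finite,'d::finite) ocp \<Rightarrow> bool" where
  "smooth_ocp N P \<longleftrightarrow>
     (\<forall>k<N. C2 (\<lambda>(x, u, e). dyn P k x u e) \<and> C2 (\<lambda>(x, u, e). cost P k x u e)) \<and>
     C2 (\<lambda>(x, e). term_cost P x e)"

definition ocp_objective :: "nat \<Rightarrow> ('x::finite,'u::finite,'d::finite) ocp \<Rightarrow> (nat \<Rightarrow> real^'d) \<Rightarrow>
    (nat \<Rightarrow> real^'x) \<Rightarrow> (nat \<Rightarrow> real^'u) \<Rightarrow> real" where
  "ocp_objective N P d x u = (\<Sum>k<N. cost P k (x k) (u k) (d k)) + term_cost P (x N) (d N)"

definition ocp_feasible :: "nat \<Rightarrow> ('x::finite,'u::finite,'d::finite) ocp \<Rightarrow> real^'x \<Rightarrow>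
    (nat \<Rightarrow> real^'d) \<Rightarrow> (nat \<Rightarrow> real^'x) \<Rightarrow> (nat \<Rightarrow> real^'u) \<Rightarrow> bool" where
  "ocp_feasible N P dinit d x u \<longleftrightarrow>
     x 0 = dinit \<and> (\<forall>k<N. x (Suc k) = dyn P k (x k) (u k) (d k))"

definition ocp_local_minimizer :: "nat \<Rightarrow> ('x::finite,'u::finite,'d::finite) ocp \<Rightarrow> real^'x \<Rightarrow>
    (nat \<Rightarrow> real^'d) \<Rightarrow> (nat \<Rightarrow> real^'x) \<Rightarrow> (nat \<Rightarrow> real^'u) \<Rightarrow> bool" where
  "ocp_local_minimizer N P dinit d x u \<longleftrightarrow>
     ocp_feasible N P dinit d x u \<and>
     (\<exists>\<epsilon>>0. \<forall>x' u'. ocp_feasible N P dinit d x' u' \<and>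
        (\<forall>k\<le>N. dist (x' k) (x k) < \<epsilon>) \<and> (\<forall>k<N. dist (u' k) (u k) < \<epsilon>) \<longrightarrow>
        ocp_objective N P d x u \<le> ocp_objective N P d x' u')"

text \<open>In \<open>stage_lagrangian P k \<mu> \<nu>\<close>, \<open>\<mu>\<close> is \<open>\<lambda>\<^sub>k\<^sub>-\<^sub>1\<close> and \<open>\<nu>\<close> is \<open>\<lambda>\<^sub>k\<close>.\<close>

definition stage_lagrangian :: "('x::finite,'u::finite,'d::finite) ocp \<Rightarrow> nat \<Rightarrow>
    real^'x \<Rightarrow> real^'x \<Rightarrow> real^'x \<Rightarrow> real^'u \<Rightarrow> real^'d \<Rightarrow> real" where
  "stage_lagrangian P k \<mu> \<nu> x u e = cost P k x u e + \<mu> \<bullet> x - \<nu> \<bullet> dyn P k x u e"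

definition term_lagrangian :: "('x::finite,'u::finite,'d::finite) ocp \<Rightarrow>
    real^'x \<Rightarrow> real^'x \<Rightarrow> real^'d \<Rightarrow> real" where
  "term_lagrangian P \<mu> x e = term_cost P x e + \<mu> \<bullet> x"

definition ocp_lagrangian :: "nat \<Rightarrow> ('x::finite,'u::finite,'d::finite) ocp \<Rightarrow> real^'x \<Rightarrow>
    (nat \<Rightarrow> real^'d) \<Rightarrow> (nat \<Rightarrow> real^'x) \<Rightarrow> (nat \<Rightarrow> real^'u) \<Rightarrow> (nat \<Rightarrow> real^'x) \<Rightarrow> real" where
  "ocp_lagrangian N P dinit d x u lam =
     (\<Sum>k<N. stage_lagrangian P k (lam k) (lam (Suc k)) (x k) (u k) (d k))
     + term_lagrangian P (lam N) (x N) (d N) - lam 0 \<bullet> dinit"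

definition ocp_primal_dual_solution :: "nat \<Rightarrow> ('x::finite,'u::finite,'d::finite) ocp \<Rightarrow> real^'x \<Rightarrow>
    (nat \<Rightarrow> real^'d) \<Rightarrow> (nat \<Rightarrow> real^'x) \<Rightarrow> (nat \<Rightarrow> real^'u) \<Rightarrow> (nat \<Rightarrow> real^'x) \<Rightarrow> bool" where
  "ocp_primal_dual_solution N P dinit d x u lam \<longleftrightarrow>
     ocp_local_minimizer N P dinit d x u \<and>
     (\<forall>k\<le>N. GDERIV (\<lambda>y. ocp_lagrangian N P dinit d (x(k := y)) u lam) (x k) :> 0) \<and>
     (\<forall>k<N. GDERIV (\<lambda>v. ocp_lagrangian N P dinit d x (u(k := v)) lam) (u k) :> 0)"


section \<open>Linear-quadratic problems\<close>

text \<open>\<open>mQ N\<close> and \<open>mD1 N\<close> are the terminal blocks \<open>Q\<^sub>N\<close> and \<open>D\<^sub>N\<close>; all other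
  components are only used for \<open>k < N\<close>.\<close>

record ('x::finite, 'u::finite, 'd::finite) lq =
  mA :: "nat \<Rightarrow> real^'x^'x"
  mB :: "nat \<Rightarrow> real^'u^'x"
  mC :: "nat \<Rightarrow> real^'d^'x"
  mQ :: "nat \<Rightarrow> real^'x^'x"
  mS :: "nat \<Rightarrow> real^'x^'u"
  mR :: "nat \<Rightarrow> real^'u^'u"
  mD1 :: "nat \<Rightarrow> real^'x^'d"
  mD2 :: "nat \<Rightarrow> real^'u^'d"

definition lq_of :: "nat \<Rightarrow> ('x::finite,'u::finite,'d::finite) ocp \<Rightarrow> (nat \<Rightarrow> real^'d) \<Rightarrow>
    (nat \<Rightarrow> real^'x) \<Rightarrow> (nat \<Rightarrow> real^'u) \<Rightarrow> (nat \<Rightarrow> real^'x) \<Rightarrow> ('x,'u,'d) lq" where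
  "lq_of N P d x u lam =
     (let L = (\<lambda>k. stage_lagrangian P k (lam k) (lam (Suc k))); LN = term_lagrangian P (lam N) in
     \<lparr> mA = (\<lambda>k. jacobian (\<lambda>y. dyn P k y (u k) (d k)) (at (x k))),
       mB = (\<lambda>k. jacobian (\<lambda>v. dyn P k (x k) v (d k)) (at (u k))),
       mC = (\<lambda>k. jacobian (\<lambda>e. dyn P k (x k) (u k) e) (at (d k))),
       mQ = (\<lambda>k. if k < N then hessian (\<lambda>y. L k y (u k) (d k)) (x k)
                 else hessian (\<lambda>y. LN y (d N)) (x N)),
       mS = (\<lambda>k. mixed_hessian (\<lambda>v y. L k y v (d k)) (u k) (x k)),
       mR = (\<lambda>k. hessian (\<lambda>v. L k (x k) v (d k)) (u k)),
       mD1 = (\<lambda>k. if k < N then mixed_hessian (\<lambda>e y. L k y (u k) e) (d k) (x k)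
                  else mixed_hessian (\<lambda>e y. LN y e) (d N) (x N)),
       mD2 = (\<lambda>k. mixed_hessian (\<lambda>e v. L k (x k) v e) (d k) (u k)) \<rparr>)"

text \<open>The stage terms are the quadratic forms of the full block matrices, written out block
  row by block row; the cross terms therefore occur twice, and there is no factor \<open>1/2\<close>.\<close>

definition lqp_objective :: "nat \<Rightarrow> ('x::finite,'u::finite,'d::finite) lq \<Rightarrow> (nat \<Rightarrow> real^'d) \<Rightarrow>
    (nat \<Rightarrow> real^'x) \<Rightarrow> (nat \<Rightarrow> real^'u) \<Rightarrow> real" where
  "lqp_objective N M l p q =
     (\<Sum>k<N. p k \<bullet> (mQ M k *v p k + transpose (mS M k) *v q k + transpose (mD1 M k) *v l k)
           + q k \<bullet> (mS M k *v p k + mR M k *v q k + transpose (mD2 M k) *v l k)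
           + l k \<bullet> (mD1 M k *v p k + mD2 M k *v q k))
     + (p N \<bullet> (mQ M N *v p N + transpose (mD1 M N) *v l N) + l N \<bullet> (mD1 M N *v p N))"

definition lqp_feasible :: "nat \<Rightarrow> ('x::finite,'u::finite,'d::finite) lq \<Rightarrow> real^'x \<Rightarrow>
    (nat \<Rightarrow> real^'d) \<Rightarrow> (nat \<Rightarrow> real^'x) \<Rightarrow> (nat \<Rightarrow> real^'u) \<Rightarrow> bool" where
  "lqp_feasible N M linit l p q \<longleftrightarrow>
     p 0 = linit \<and> (\<forall>k<N. p (Suc k) = mA M k *v p k + mB M k *v q k + mC M k *v l k)"

definition lqp_lagrangian :: "nat \<Rightarrow> ('x::finite,'u::finite,'d::finite) lq \<Rightarrow> real^'x \<Rightarrow>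
    (nat \<Rightarrow> real^'d) \<Rightarrow> (nat \<Rightarrow> real^'x) \<Rightarrow> (nat \<Rightarrow> real^'u) \<Rightarrow> (nat \<Rightarrow> real^'x) \<Rightarrow> real" where
  "lqp_lagrangian N M linit l p q \<zeta> =
     lqp_objective N M l p q
     + (\<Sum>k<N. \<zeta> (Suc k) \<bullet> (p (Suc k) - mA M k *v p k - mB M k *v q k - mC M k *v l k))
     + \<zeta> 0 \<bullet> (p 0 - linit)"

definition lqp_primal_dual_solution :: "nat \<Rightarrow> ('x::finite,'u::finite,'d::finite) lq \<Rightarrow> real^'x \<Rightarrow>
    (nat \<Rightarrow> real^'d) \<Rightarrow> (nat \<Rightarrow> real^'x) \<Rightarrow> (nat \<Rightarrow> real^'u) \<Rightarrow> (nat \<Rightarrow> real^'x) \<Rightarrow> bool" where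
  "lqp_primal_dual_solution N M linit l p q \<zeta> \<longleftrightarrow>
     lqp_feasible N M linit l p q \<and>
     (\<forall>p' q'. lqp_feasible N M linit l p' q' \<longrightarrow>
        lqp_objective N M l p q \<le> lqp_objective N M l p' q') \<and>
     (\<forall>k\<le>N. GDERIV (\<lambda>y. lqp_lagrangian N M linit l (p(k := y)) q \<zeta>) (p k) :> 0) \<and>
     (\<forall>k<N. GDERIV (\<lambda>v. lqp_lagrangian N M linit l p (q(k := v)) \<zeta>) (q k) :> 0)"


section \<open>The reduced Hessian\<close>

text \<open>The dimension of \<open>z = (x\<^sub>0; u\<^sub>0; \<dots>; x\<^sub>N)\<close> depends on \<open>N\<close>, so matrices acting on it are
  functions on explicit finite index sets. An index \<open>(k, Inl a)\<close> is component \<open>a\<close> of \<open>x\<^sub>k\<close>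
  and \<open>(k, Inr b)\<close> is component \<open>b\<close> of \<open>u\<^sub>k\<close>.\<close>

definition z_idx :: "nat \<Rightarrow> (nat \<times> ('x::finite + 'u::finite)) set" where
  "z_idx N = {..N} \<times> range Inl \<union> {..<N} \<times> range Inr"

definition con_idx :: "nat \<Rightarrow> (nat \<times> 'x::finite) set" where
  "con_idx N = {..N} \<times> UNIV"

definition stage_hessian :: "('x::finite,'u::finite,'d::finite) lq \<Rightarrow> nat \<Rightarrow> real^('x+'u)^('x+'u)" where
  "stage_hessian M k = (\<chi> i j. case (i, j) of
       (Inl a, Inl b) \<Rightarrow> mQ M k $ a $ b
     | (Inl a, Inr b) \<Rightarrow> transpose (mS M k) $ a $ b
     | (Inr a, Inl b) \<Rightarrow> mS M k $ a $ b
     | (Inr a, Inr b) \<Rightarrow> mR M k $ a $ b)"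

definition full_hessian :: "('x::finite,'u::finite,'d::finite) lq \<Rightarrow>
    nat \<times> ('x + 'u) \<Rightarrow> nat \<times> ('x + 'u) \<Rightarrow> real" where
  "full_hessian M = (\<lambda>(k, i) (k', j). if k = k' then stage_hessian M k $ i $ j else 0)"

text \<open>Block row \<open>0\<close> is \<open>z \<mapsto> x\<^sub>0\<close>; block row \<open>Suc k\<close> is
  \<open>z \<mapsto> x\<^sub>k\<^sub>+\<^sub>1 - A\<^sub>k x\<^sub>k - B\<^sub>k u\<^sub>k\<close>.\<close>

definition con_jacobian :: "('x::finite,'u::finite,'d::finite) lq \<Rightarrow>
    nat \<times> 'x \<Rightarrow> nat \<times> ('x + 'u) \<Rightarrow> real" where
  "con_jacobian M = (\<lambda>(r, a) (k, j).
     if r = k then (case j of Inl b \<Rightarrow> if a = b then 1 else 0 | Inr _ \<Rightarrow> 0)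
     else if r = Suc k then (case j of Inl b \<Rightarrow> - mA M k $ a $ b | Inr b \<Rightarrow> - mB M k $ a $ b)
     else 0)"

text \<open>\<open>Z\<close> has \<open>m\<close> columns, and they form an orthonormal basis of the kernel of the matrix \<open>G\<close>
  with row index set \<open>I\<close> and column index set \<open>J\<close>. Linear independence follows from
  orthonormality.\<close>

definition orthonormal_kernel_basis :: "'r set \<Rightarrow> 'c set \<Rightarrow> ('r \<Rightarrow> 'c \<Rightarrow> real) \<Rightarrow>
    nat \<Rightarrow> ('c \<Rightarrow> nat \<Rightarrow> real) \<Rightarrow> bool" where
  "orthonormal_kernel_basis I J G m Z \<longleftrightarrow>
     (\<forall>s<m. \<forall>r\<in>I. (\<Sum>c\<in>J. G r c * Z c s) = 0) \<and>
     (\<forall>s<m. \<forall>t<m. (\<Sum>c\<in>J. Z c s * Z c t) = (if s = t then 1 else 0)) \<and>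
     (\<forall>z. (\<forall>r\<in>I. (\<Sum>c\<in>J. G r c * z c) = 0) \<longrightarrow>
        (\<exists>v. \<forall>c\<in>J. z c = (\<Sum>s<m. Z c s * v s)))"

definition reduced_hessian :: "nat \<Rightarrow> ('x::finite,'u::finite,'d::finite) lq \<Rightarrow>
    (nat \<times> ('x + 'u) \<Rightarrow> nat \<Rightarrow> real) \<Rightarrow> nat \<Rightarrow> nat \<Rightarrow> real" where
  "reduced_hessian N M Z s t = (\<Sum>a\<in>z_idx N. \<Sum>b\<in>z_idx N. Z a s * full_hessian M a b * Z b t)"

text \<open>\<open>W \<succeq> \<gamma> I\<close> for an \<open>m \<times> m\<close> matrix \<open>W\<close>.\<close>

definition loewner_ge :: "nat \<Rightarrow> (nat \<Rightarrow> nat \<Rightarrow> real) \<Rightarrow> real \<Rightarrow> bool" where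
  "loewner_ge m W \<gamma> \<longleftrightarrow>
     (\<forall>v :: nat \<Rightarrow> real. (\<Sum>s<m. \<Sum>t<m. v s * W s t * v t) \<ge> \<gamma> * (\<Sum>s<m. (v s)\<^sup>2))"


section \<open>The convexification procedure\<close>

text \<open>In the following block updates \<open>X\<close> stands for \<open>\<bar>Q\<^sub>k\<^sub>+\<^sub>1\<close>; \<open>mat \<beta>\<close> is \<open>\<beta> I\<close>.\<close>

definition Qhat :: "('x::finite,'u::finite,'d::finite) lq \<Rightarrow> nat \<Rightarrow> real^'x^'x \<Rightarrow> real^'x^'x" where
  "Qhat M k X = mQ M k + transpose (mA M k) ** X ** mA M k"

definition Stilde :: "('x::finite,'u::finite,'d::finite) lq \<Rightarrow> nat \<Rightarrow> real^'x^'x \<Rightarrow> real^'x^'u" where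
  "Stilde M k X = mS M k + transpose (mB M k) ** X ** mA M k"

definition Rtilde :: "('x::finite,'u::finite,'d::finite) lq \<Rightarrow> nat \<Rightarrow> real^'x^'x \<Rightarrow> real^'u^'u" where
  "Rtilde M k X = mR M k + transpose (mB M k) ** X ** mB M k"

definition D1tilde :: "('x::finite,'u::finite,'d::finite) lq \<Rightarrow> nat \<Rightarrow> real^'x^'x \<Rightarrow> real^'x^'d" where
  "D1tilde M k X = mD1 M k + transpose (mC M k) ** X ** mA M k"

definition D2tilde :: "('x::finite,'u::finite,'d::finite) lq \<Rightarrow> nat \<Rightarrow> real^'x^'x \<Rightarrow> real^'u^'d" where
  "D2tilde M k X = mD2 M k + transpose (mC M k) ** X ** mB M k"

definition Qtilde :: "real \<Rightarrow> ('x::finite,'u::finite,'d::finite) lq \<Rightarrow> nat \<Rightarrow> real^'x^'x \<Rightarrow> real^'x^'x" where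
  "Qtilde \<beta> M k X =
     transpose (Stilde M k X) ** matrix_inv (Rtilde M k X) ** Stilde M k X + mat \<beta>"

function Qbar :: "nat \<Rightarrow> real \<Rightarrow> ('x::finite,'u::finite,'d::finite) lq \<Rightarrow> nat \<Rightarrow> real^'x^'x" where
  "Qbar N \<beta> M k =
     (if k < N then Qhat M k (Qbar N \<beta> M (Suc k)) - Qtilde \<beta> M k (Qbar N \<beta> M (Suc k))
      else mQ M N - mat \<beta>)"
  by pat_completeness auto
termination by (relation "Wellfounded.measure (\<lambda>(N, \<beta>, M, k). N - k)") auto

declare Qbar.simps [simp del]

definition convexify :: "nat \<Rightarrow> real \<Rightarrow> ('x::finite,'u::finite,'d::finite) lq \<Rightarrow> ('x,'u,'d) lq" where
  "convexify N \<beta> M = M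
     \<lparr> mQ := (\<lambda>k. if k < N then Qtilde \<beta> M k (Qbar N \<beta> M (Suc k)) else mat \<beta>),
       mS := (\<lambda>k. Stilde M k (Qbar N \<beta> M (Suc k))),
       mR := (\<lambda>k. Rtilde M k (Qbar N \<beta> M (Suc k))),
       mD1 := (\<lambda>k. if k < N then D1tilde M k (Qbar N \<beta> M (Suc k)) else mD1 M N),
       mD2 := (\<lambda>k. D2tilde M k (Qbar N \<beta> M (Suc k))) \<rparr>"

end

theory Submission
  imports Defs
begin

text \<open>Write \<open>\<bar>Q\<^sub>k\<close> for \<open>Qbar\<close>. Along the (affine) dynamics, each stage cost of \<open>LQP\<close> differs from the
  convexified one by \<open>p\<^sub>k\<^sup>T \<bar>Q\<^sub>k p\<^sub>k - p\<^sub>k\<^sub>+\<^sub>1\<^sup>T \<bar>Q\<^sub>k\<^sub>+\<^sub>1 p\<^sub>k\<^sub>+\<^sub>1\<close> plus a term depending on \<open>l\<close> only. The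
  differences telescope, so both objectives agree on the feasible set up to a constant, and the
  common minimizer is unique because the reduced Hessian is positive definite. The multipliers are
  then compared by backward induction in the costate recursion.

  All of this needs \<open>\<bar>Q\<^sub>k\<close> symmetric. The symmetry of \<open>Q\<^sub>k\<close> and \<open>R\<^sub>k\<close> is Schwarz's theorem; since
  \<open>Qtilde\<close> contains the inverse of \<open>Rtilde\<close>, which is junk for a singular matrix, it also has to be
  shown that \<open>Rtilde\<close> is positive definite. This comes from testing the reduced Hessian on the
  trajectory that rests up to stage \<open>k\<close>, applies the control \<open>v\<close> there, and afterwards uses the
  feedback minimizing the convexified stages: its cost is \<open>v\<^sup>T Rtilde v + \<beta> \<Sum> \<bar>p\<^sub>j\<bar>\<^sup>2\<close>.\<close>

section \<open>Symmetry of Hessians\<close>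

text \<open>The second derivative is recorded for each fixed direction \<open>a\<close>, as the
  derivative of \<open>y \<mapsto> D y a\<close>. In this form Schwarz's theorem applies directly,
  and sums and affine substitutions are handled without operator spaces.\<close>

definition twice_differentiable :: "('a::real_normed_vector \<Rightarrow> 'b::real_normed_vector) \<Rightarrow> bool" where
  "twice_differentiable f \<longleftrightarrow> (\<exists>D E. (\<forall>x. (f has_derivative D x) (at x)) \<and>
     (\<forall>x a. ((\<lambda>y. D y a) has_derivative E x a) (at x)))"

lemma C2_imp_twice_differentiable:
  assumes "C2 f"
  shows "twice_differentiable f"
proof -
  obtain f' f'' where f': "\<And>x. (f has_derivative blinfun_apply (f' x)) (at x)"
    and f'': "\<And>x. (f' has_derivative blinfun_apply (f'' x)) (at x)"
    using assms unfolding C2_def by blast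
  have "((\<lambda>y. blinfun_apply (f' y) a) has_derivative (\<lambda>h. blinfun_apply (blinfun_apply (f'' x) h) a)) (at x)" for x a
    by (auto intro!: derivative_eq_intros f'' simp: blinfun.bilinear_simps)
  with f' show ?thesis
    unfolding twice_differentiable_def
    by (intro exI[of _ "\<lambda>x. blinfun_apply (f' x)"]
        exI[of _ "\<lambda>x a h. blinfun_apply (blinfun_apply (f'' x) h) a"]) auto
qed

lemma bounded_linear_imp_twice_differentiable:
  assumes "bounded_linear f"
  shows "twice_differentiable f"
  unfolding twice_differentiable_def
proof (intro exI conjI allI)
  show "(f has_derivative f) (at x)" for x
    by (rule bounded_linear_imp_has_derivative[OF assms])
  show "((\<lambda>y. f a) has_derivative (\<lambda>_. 0)) (at x)" for x a
    by (rule has_derivative_const)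
qed

lemma twice_differentiable_add:
  assumes "twice_differentiable f" "twice_differentiable g"
  shows "twice_differentiable (\<lambda>x. f x + g x)"
proof -
  obtain D E D' E' where "\<And>x. (f has_derivative D x) (at x)"
    "\<And>x a. ((\<lambda>y. D y a) has_derivative E x a) (at x)"
    "\<And>x. (g has_derivative D' x) (at x)"
    "\<And>x a. ((\<lambda>y. D' y a) has_derivative E' x a) (at x)"
    using assms unfolding twice_differentiable_def by metis
  then show ?thesis
    unfolding twice_differentiable_def
    by (intro exI[of _ "\<lambda>x h. D x h + D' x h"] exI[of _ "\<lambda>x a h. E x a h + E' x a h"])
      (auto intro!: has_derivative_add)
qed

lemma twice_differentiable_linear_compose:
  assumes "bounded_linear j" "twice_differentiable f"
  shows "twice_differentiable (\<lambda>x. j (f x))"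
proof -
  obtain D E where "\<And>x. (f has_derivative D x) (at x)"
    "\<And>x a. ((\<lambda>y. D y a) has_derivative E x a) (at x)"
    using assms unfolding twice_differentiable_def by metis
  then show ?thesis
    unfolding twice_differentiable_def
    by (intro exI[of _ "\<lambda>x h. j (D x h)"] exI[of _ "\<lambda>x a h. j (E x a h)"])
      (auto intro!: bounded_linear.has_derivative[OF assms(1)])
qed

lemma twice_differentiable_compose_affine:
  assumes f: "twice_differentiable f" and j: "bounded_linear j"
  shows "twice_differentiable (\<lambda>x. f (c + j x))"
proof -
  obtain D E where D: "\<And>x. (f has_derivative D x) (at x)"
    and E: "\<And>x a. ((\<lambda>y. D y a) has_derivative E x a) (at x)"
    using assms unfolding twice_differentiable_def by metis
  have J: "((\<lambda>x. c + j x) has_derivative j) (at x)" for x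
    using has_derivative_add[OF has_derivative_const bounded_linear_imp_has_derivative[OF j]] by simp
  show ?thesis
    unfolding twice_differentiable_def
    using has_derivative_compose[OF J D] has_derivative_compose[OF J E]
    by (intro exI[of _ "\<lambda>x h. D (c + j x) (j h)"] exI[of _ "\<lambda>x a h. E (c + j x) (j a) (j h)"]) auto
qed

text \<open>The mean value theorem along \<open>s \<mapsto> f (x + t b + s a) - f (x + s a)\<close> compares the
  second difference with \<open>t\<^sup>2 E b\<close>; the second difference is symmetric in \<open>a\<close> and \<open>b\<close>.\<close>

lemma second_difference_estimate:
  fixes f :: "'a::real_normed_vector \<Rightarrow> real"
  assumes f: "\<And>y. (f has_derivative D y) (at y)"
    and E: "((\<lambda>y. D y a) has_derivative E) (at x)" and "\<epsilon> > 0"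
  shows "eventually (\<lambda>t. \<bar>f (x + t *\<^sub>R b + t *\<^sub>R a) - f (x + t *\<^sub>R b) - f (x + t *\<^sub>R a) + f x
     - t\<^sup>2 * E b\<bar> \<le> t\<^sup>2 * (2 * \<epsilon> * (norm a + norm b))) (at_right 0)"
proof -
  interpret E: bounded_linear E using E by (rule has_derivative_bounded_linear)
  interpret D: bounded_linear "D y" for y using f by (rule has_derivative_bounded_linear)
  obtain \<delta> where "\<delta> > 0" and \<delta>: "\<And>h. norm h < \<delta> \<Longrightarrow> \<bar>D (x + h) a - D x a - E h\<bar> \<le> \<epsilon> * norm h"
  proof -
    obtain \<delta> where "\<delta> > 0" and *: "\<And>y. norm (y - x) < \<delta> \<Longrightarrow> norm (D y a - D x a - E (y - x)) \<le> \<epsilon> * norm (y - x)"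
      using E \<open>\<epsilon> > 0\<close> unfolding has_derivative_at_alt by blast
    show ?thesis
      by (rule that[OF \<open>\<delta> > 0\<close>]) (use *[of "x + _"] in simp)
  qed
  \<comment> \<open>The bound on \<open>t\<close> keeps every evaluation point within \<delta> of
    \<open>x\<close>; the summand 1 keeps the denominator positive when \<open>a\<close> and
    \<open>b\<close> are both zero.\<close>
  have "\<bar>f (x + t *\<^sub>R b + t *\<^sub>R a) - f (x + t *\<^sub>R b) - f (x + t *\<^sub>R a) + f x - t\<^sup>2 * E b\<bar>
      \<le> t\<^sup>2 * (2 * \<epsilon> * (norm a + norm b))"
    if t: "0 < t" "t < \<delta> / (norm a + norm b + 1)" for t
  proof -
    define \<phi> where "\<phi> s = f (x + t *\<^sub>R b + s *\<^sub>R a) - f (x + s *\<^sub>R a)" for s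
    have "(\<phi> has_derivative (\<lambda>h. D (x + t *\<^sub>R b + s *\<^sub>R a) (h *\<^sub>R a) - D (x + s *\<^sub>R a) (h *\<^sub>R a))) (at s)" for s
      unfolding \<phi>_def
      by (rule has_derivative_diff; rule has_derivative_compose[OF _ f])
        (auto intro!: derivative_eq_intros)
    then have "(\<phi> has_real_derivative (D (x + t *\<^sub>R b + s *\<^sub>R a) a - D (x + s *\<^sub>R a) a)) (at s)" for s
      by (rule has_derivative_imp_has_field_derivative) (simp add: D.scaleR algebra_simps)
    from MVT2[OF t(1) this] obtain s where s: "0 < s" "s < t"
      and \<phi>: "\<phi> t - \<phi> 0 = t * (D (x + t *\<^sub>R b + s *\<^sub>R a) a - D (x + s *\<^sub>R a) a)"
      by auto
    have "t * (norm a + norm b) \<le> t * (norm a + norm b + 1)"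
      using t by simp
    also have "\<dots> < \<delta>"
      using t by (simp add: pos_less_divide_eq add_nonneg_pos)
    finally have small: "t * (norm a + norm b) < \<delta>" .
    have sa: "norm (s *\<^sub>R a) \<le> t * (norm a + norm b)"
      using s t by (simp add: mult_mono)
    have "s * norm a \<le> t * norm a"
      using s by (intro mult_right_mono) auto
    then have tb: "norm (t *\<^sub>R b + s *\<^sub>R a) \<le> t * (norm a + norm b)"
      using norm_triangle_ineq[of "t *\<^sub>R b" "s *\<^sub>R a"] s t by (simp add: algebra_simps)
    have 1: "\<bar>D (x + (t *\<^sub>R b + s *\<^sub>R a)) a - D x a - E (t *\<^sub>R b + s *\<^sub>R a)\<bar> \<le> \<epsilon> * (t * (norm a + norm b))"
      using \<delta>[of "t *\<^sub>R b + s *\<^sub>R a"] tb small mult_left_mono[OF tb, of \<epsilon>] \<open>\<epsilon> > 0\<close> by linarith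
    have 2: "\<bar>D (x + s *\<^sub>R a) a - D x a - E (s *\<^sub>R a)\<bar> \<le> \<epsilon> * (t * (norm a + norm b))"
      using \<delta>[of "s *\<^sub>R a"] sa small mult_left_mono[OF sa, of \<epsilon>] \<open>\<epsilon> > 0\<close> by linarith
    \<comment> \<open>Both values of \<open>D\<close> are expanded around \<open>x\<close>. On
      subtraction \<open>D x a\<close> and \<open>E (s *\<^sub>R a)\<close> cancel,
      \<open>t * E b\<close> remains, and the two errors add.\<close>
    have "\<bar>D (x + t *\<^sub>R b + s *\<^sub>R a) a - D (x + s *\<^sub>R a) a - t * E b\<bar> \<le> 2 * (\<epsilon> * (t * (norm a + norm b)))"
      using 1 2 by (simp add: E.add E.scaleR add.assoc)
    then have "t * \<bar>D (x + t *\<^sub>R b + s *\<^sub>R a) a - D (x + s *\<^sub>R a) a - t * E b\<bar>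
        \<le> t * (2 * (\<epsilon> * (t * (norm a + norm b))))"
      using t by (intro mult_left_mono) auto
    moreover have "t * \<bar>D (x + t *\<^sub>R b + s *\<^sub>R a) a - D (x + s *\<^sub>R a) a - t * E b\<bar>
        = \<bar>\<phi> t - \<phi> 0 - t\<^sup>2 * E b\<bar>"
      using t unfolding \<phi> by (simp add: abs_mult_pos' algebra_simps power2_eq_square)
    ultimately show ?thesis
      by (simp add: \<phi>_def algebra_simps power2_eq_square)
  qed
  moreover have "0 < \<delta> / (norm a + norm b + 1)"
    using \<open>\<delta> > 0\<close> by (simp add: add_nonneg_pos)
  ultimately show ?thesis
    unfolding eventually_at_right_field by blast
qed

text \<open>For small \<open>t\<close> one and the same second difference approximates both
  \<open>t\<^sup>2 * E a b\<close> and \<open>t\<^sup>2 * E b a\<close>. Dividing by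
  \<open>t\<^sup>2\<close> makes the two values arbitrarily close.\<close>

lemma second_derivative_symmetric:
  fixes f :: "'a::real_normed_vector \<Rightarrow> real"
  assumes f: "\<And>y. (f has_derivative D y) (at y)"
    and E: "\<And>a. ((\<lambda>y. D y a) has_derivative E a) (at x)"
  shows "E a b = E b a"
proof -
  have "\<bar>E a b - E b a\<bar> \<le> 0 + e" if "e > 0" for e
  proof -
    \<comment> \<open>Chosen so that the two error bounds together stay below
      \<open>e\<close>.\<close>
    define \<epsilon> where "\<epsilon> = e / (4 * (norm a + norm b + 1))"
    have pos: "norm a + norm b + 1 > 0" by (simp add: add_nonneg_pos)
    then have "\<epsilon> > 0" using that by (simp add: \<epsilon>_def)
    obtain t :: real where "t > 0"
      and 1: "\<bar>f (x + t *\<^sub>R b + t *\<^sub>R a) - f (x + t *\<^sub>R b) - f (x + t *\<^sub>R a) + f x - t\<^sup>2 * E a b\<bar>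
        \<le> t\<^sup>2 * (2 * \<epsilon> * (norm a + norm b))"
      and 2: "\<bar>f (x + t *\<^sub>R a + t *\<^sub>R b) - f (x + t *\<^sub>R a) - f (x + t *\<^sub>R b) + f x - t\<^sup>2 * E b a\<bar>
        \<le> t\<^sup>2 * (2 * \<epsilon> * (norm b + norm a))"
      using eventually_happens'[OF trivial_limit_at_right_real eventually_conj[OF
          second_difference_estimate[OF f E \<open>\<epsilon> > 0\<close>, of a b]
          eventually_conj[OF second_difference_estimate[OF f E \<open>\<epsilon> > 0\<close>, of b a]
            eventually_at_right_less]]]
      by auto
    have swap: "x + t *\<^sub>R a + t *\<^sub>R b = x + t *\<^sub>R b + t *\<^sub>R a" "norm b + norm a = norm a + norm b"
      by auto
    have "t\<^sup>2 * (4 * \<epsilon> * (norm a + norm b)) = 2 * (t\<^sup>2 * (2 * \<epsilon> * (norm a + norm b)))"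
      by simp
    then have "\<bar>t\<^sup>2 * E a b - t\<^sup>2 * E b a\<bar> \<le> t\<^sup>2 * (4 * \<epsilon> * (norm a + norm b))"
      using 1 2[unfolded swap] by linarith
    also have "\<bar>t\<^sup>2 * E a b - t\<^sup>2 * E b a\<bar> = t\<^sup>2 * \<bar>E a b - E b a\<bar>"
      by (simp add: right_diff_distrib[symmetric] abs_mult)
    finally have "\<bar>E a b - E b a\<bar> \<le> 4 * \<epsilon> * (norm a + norm b)"
      using \<open>t > 0\<close> by simp
    also have "\<dots> \<le> 4 * \<epsilon> * (norm a + norm b + 1)"
      using \<open>\<epsilon> > 0\<close> by simp
    also have "\<dots> = e"
      using pos by (simp add: \<epsilon>_def field_simps)
    finally show ?thesis by simp
  qed
  then show ?thesis
    using field_le_epsilon[of "\<bar>E a b - E b a\<bar>" 0] by auto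
qed

text \<open>The gradient has the components \<open>D y (axis i 1)\<close>, so the entries of the
  Hessian are second derivatives along pairs of axes, to which Schwarz's theorem applies.\<close>

lemma transpose_hessian:
  fixes f :: "real^'n \<Rightarrow> real"
  assumes "twice_differentiable f"
  shows "transpose (hessian f x) = hessian f x"
proof -
  obtain D E where D: "\<And>x. (f has_derivative D x) (at x)"
    and E: "\<And>x a. ((\<lambda>y. D y a) has_derivative E x a) (at x)"
    using assms unfolding twice_differentiable_def by metis
  have grad: "gradient f y = (\<chi> i. D y (axis i 1))" for y
  proof (rule gradient_eq)
    interpret D: bounded_linear "D y" using D by (rule has_derivative_bounded_linear)
    have "D y h = h \<bullet> (\<chi> i. D y (axis i 1))" for h
    proof -
      have "D y h = D y (\<Sum>i\<in>UNIV. h $ i *s axis i 1)"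
        by (simp only: basis_expansion)
      also have "\<dots> = h \<bullet> (\<chi> i. D y (axis i 1))"
        by (simp add: D.sum D.scaleR inner_vec_def scalar_mult_eq_scaleR)
      finally show ?thesis .
    qed
    then show "GDERIV f y :> (\<chi> i. D y (axis i 1))"
      unfolding gderiv_def by (intro has_derivative_eq_rhs[OF D]) (rule ext)
  qed
  have "((\<lambda>y. \<chi> i. D y (axis i 1)) has_derivative (\<lambda>h. \<chi> i. E x (axis i 1) h)) (at x)"
  proof (subst has_derivative_componentwise_within, rule ballI)
    fix b :: "real^'n" assume "b \<in> Basis"
    then obtain i where "b = axis i 1" by (auto simp: Basis_vec_def)
    then show "((\<lambda>y. (\<chi> i. D y (axis i 1)) \<bullet> b) has_derivative (\<lambda>h. (\<chi> i. E x (axis i 1) h) \<bullet> b)) (at x)"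
      using E[of "axis i 1" x] by (simp add: inner_axis)
  qed
  then have "(gradient f has_derivative (\<lambda>h. \<chi> i. E x (axis i 1) h)) (at x)"
    by (simp add: grad[abs_def])
  then have "hessian f x = matrix (\<lambda>h. \<chi> i. E x (axis i 1) h)"
    unfolding hessian_def jacobian_def using frechet_derivative_at by metis
  then show ?thesis
    using second_derivative_symmetric[OF D E] by (simp add: matrix_def transpose_def)
qed

section \<open>Symmetry of the Hessian blocks of the Lagrangian\<close>

lemma twice_differentiable_stage_lagrangian:
  assumes "smooth_ocp N P" "k < N"
  shows "twice_differentiable (\<lambda>(x, u, e). stage_lagrangian P k \<mu> \<nu> x u e)"
proof -
  have "twice_differentiable (\<lambda>(x, u, e). dyn P k x u e)" (is "twice_differentiable ?f")
    and c: "twice_differentiable (\<lambda>(x, u, e). cost P k x u e)" (is "twice_differentiable ?g")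
    using assms by (auto simp: smooth_ocp_def C2_imp_twice_differentiable)
  moreover have "bounded_linear (\<lambda>y. - (\<nu> \<bullet> y))"
    by (intro bounded_linear_minus bounded_linear_inner_right)
  ultimately have "twice_differentiable (\<lambda>z. - (\<nu> \<bullet> ?f z))"
    by (intro twice_differentiable_linear_compose[where j = "\<lambda>y. - (\<nu> \<bullet> y)"])
  moreover have "twice_differentiable (\<lambda>z. \<mu> \<bullet> fst z)"
    by (intro bounded_linear_imp_twice_differentiable bounded_linear_inner_right_comp bounded_linear_fst)
  ultimately have "twice_differentiable (\<lambda>z. ?g z + \<mu> \<bullet> fst z + - (\<nu> \<bullet> ?f z))"
    using c by (intro twice_differentiable_add)
  then show ?thesis
    by (simp add: stage_lagrangian_def split_def)
qed

lemma transpose_mQ_lq_of: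
  assumes "smooth_ocp N P"
  shows "transpose (mQ (lq_of N P d x u lam) k) = mQ (lq_of N P d x u lam) k"
proof (cases "k < N")
  case True
  have "bounded_linear (\<lambda>y :: real^'a. (y, 0 :: real^'b, 0 :: real^'c))"
    by (intro bounded_linear_Pair bounded_linear_ident bounded_linear_zero)
  \<comment> \<open>Freezing control and data is composition with the affine embedding
    \<open>y \<mapsto> (0, u k, d k) + (y, 0, 0)\<close>.\<close>
  from twice_differentiable_compose_affine[OF twice_differentiable_stage_lagrangian[OF assms True] this, of _ _ "(0, u k, d k)"]
  show ?thesis
    using True by (simp add: lq_of_def Let_def transpose_hessian)
\<comment> \<open>Every \<open>k \<ge> N\<close> selects the terminal block in
  \<open>lq_of\<close>.\<close>
next
  case False
  have "twice_differentiable (\<lambda>(x, e). term_cost P x e)"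
    using assms by (simp add: smooth_ocp_def C2_imp_twice_differentiable)
  moreover have "bounded_linear (\<lambda>y :: real^'a. (y, 0 :: real^'c))"
    by (intro bounded_linear_Pair bounded_linear_ident bounded_linear_zero)
  ultimately have "twice_differentiable (\<lambda>y. case (0, d N) + (y, 0) of (x, e) \<Rightarrow> term_cost P x e)"
    by (rule twice_differentiable_compose_affine)
  moreover have "twice_differentiable (\<lambda>y. lam N \<bullet> y)"
    by (intro bounded_linear_imp_twice_differentiable bounded_linear_inner_right)
  ultimately have "twice_differentiable (\<lambda>y. (case (0, d N) + (y, 0) of (x, e) \<Rightarrow> term_cost P x e) + lam N \<bullet> y)"
    by (rule twice_differentiable_add)
  then show ?thesis
    using False by (simp add: lq_of_def Let_def term_lagrangian_def transpose_hessian)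
qed

lemma transpose_mR_lq_of:
  assumes "smooth_ocp N P" "k < N"
  shows "transpose (mR (lq_of N P d x u lam) k) = mR (lq_of N P d x u lam) k"
proof -
  have "bounded_linear (\<lambda>v :: real^'b. (0 :: real^'a, v, 0 :: real^'c))"
    by (intro bounded_linear_Pair bounded_linear_ident bounded_linear_zero)
  from twice_differentiable_compose_affine[OF twice_differentiable_stage_lagrangian[OF assms] this, of _ _ "(x k, 0, d k)"]
  show ?thesis
    by (simp add: lq_of_def Let_def transpose_hessian)
qed

section \<open>Convexification of linear-quadratic problems\<close>

text \<open>The simplifier rewrites \<open>transpose A *v y\<close> to \<open>y v* A\<close>, so
  this is the form in which adjoints are moved across an inner product.\<close>

lemma inner_vector_matrix_mult:
  fixes A :: "real^'n^'m"
  shows "x \<bullet> (y v* A) = y \<bullet> (A *v x)"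
  by (metis dot_lmul_matrix inner_commute)

lemma inner_symmetric_matrix:
  fixes A :: "real^'n^'n"
  assumes "transpose A = A"
  shows "x \<bullet> (A *v y) = y \<bullet> (A *v x)"
  by (metis assms inner_vector_matrix_mult transpose_matrix_vector)

lemma mat_vector_mult: "mat c *v x = c *\<^sub>R (x :: real^'n)"
  by (simp add: vec_eq_iff matrix_vector_mult_def mat_def if_distrib[of "\<lambda>c. c * _"] sum.delta cong: if_cong)

lemma transpose_add: "transpose (A + B) = transpose A + transpose (B :: 'a::plus^'n^'m)"
  by (simp add: transpose_def vec_eq_iff)

lemma transpose_diff: "transpose (A - B) = transpose A - transpose (B :: 'a::minus^'n^'m)"
  by (simp add: transpose_def vec_eq_iff)

lemma transpose_congruence:
  fixes X :: "real^'n^'n" and A :: "real^'m^'n" and B :: "real^'k^'n"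
  assumes "transpose X = X"
  shows "transpose (transpose B ** X ** A) = transpose A ** X ** B"
  by (simp add: matrix_transpose_mul assms matrix_mul_assoc)

lemma matrix_inv_inverse:
  fixes A :: "real^'n^'n"
  assumes "invertible A"
  shows "A ** matrix_inv A = mat 1" "matrix_inv A ** A = mat 1"
  using someI_ex[OF assms[unfolded invertible_def]] unfolding matrix_inv_def by auto

lemma transpose_matrix_inv:
  fixes A :: "real^'n^'n"
  assumes "invertible A" "transpose A = A"
  shows "transpose (matrix_inv A) = matrix_inv A"
proof -
  have "A ** transpose (matrix_inv A) = mat 1"
    by (metis assms matrix_inv_inverse(2) matrix_transpose_mul transpose_mat)
  then show ?thesis
    by (metis assms(1) matrix_inv_inverse(2) matrix_mul_assoc matrix_mul_lid matrix_mul_rid)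
qed

lemma invertible_if_positive:
  fixes A :: "real^'n^'n"
  assumes "\<And>v. v \<noteq> 0 \<Longrightarrow> v \<bullet> (A *v v) > 0"
  shows "invertible A"
proof -
  have "v = 0" if "A *v v = 0" for v
    using assms[of v] that by fastforce
  then show ?thesis
    using invertible_left_inverse matrix_left_invertible_ker by blast
qed

section \<open>Stage quadratic forms and the telescoping identity\<close>

text \<open>Off-diagonal blocks occur in transposed pairs, so each pair becomes one inner product
  counted twice and no transposes remain.\<close>

definition stage_form :: "('x::finite,'u::finite,'d::finite) lq \<Rightarrow> nat \<Rightarrow>
    real^'x \<Rightarrow> real^'u \<Rightarrow> real^'d \<Rightarrow> real" where
  "stage_form M k p q e = p \<bullet> (mQ M k *v p) + q \<bullet> (mR M k *v q)
     + 2 * (q \<bullet> (mS M k *v p) + e \<bullet> (mD1 M k *v p) + e \<bullet> (mD2 M k *v q))"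

definition term_form :: "nat \<Rightarrow> ('x::finite,'u::finite,'d::finite) lq \<Rightarrow>
    real^'x \<Rightarrow> real^'d \<Rightarrow> real" where
  "term_form N M p e = p \<bullet> (mQ M N *v p) + 2 * (e \<bullet> (mD1 M N *v p))"

lemma lqp_objective_eq:
  "lqp_objective N M l p q = (\<Sum>k<N. stage_form M k (p k) (q k) (l k)) + term_form N M (p N) (l N)"
  unfolding lqp_objective_def stage_form_def term_form_def
  by (simp add: inner_add_right inner_vector_matrix_mult)
    (rule sum.cong; simp add: algebra_simps)

lemma convexify_simps:
  "mA (convexify N \<beta> M) = mA M" "mB (convexify N \<beta> M) = mB M" "mC (convexify N \<beta> M) = mC M"
  "mQ (convexify N \<beta> M) k = (if k < N then Qtilde \<beta> M k (Qbar N \<beta> M (Suc k)) else mat \<beta>)"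
  "mS (convexify N \<beta> M) k = Stilde M k (Qbar N \<beta> M (Suc k))"
  "mR (convexify N \<beta> M) k = Rtilde M k (Qbar N \<beta> M (Suc k))"
  "mD1 (convexify N \<beta> M) k = (if k < N then D1tilde M k (Qbar N \<beta> M (Suc k)) else mD1 M N)"
  "mD2 (convexify N \<beta> M) k = D2tilde M k (Qbar N \<beta> M (Suc k))"
  by (simp_all add: convexify_def)

lemma lqp_feasible_convexify:
  "lqp_feasible N (convexify N \<beta> M) linit l p q = lqp_feasible N M linit l p q"
  by (simp add: lqp_feasible_def convexify_simps)

text \<open>The block update adds the form of \<open>X\<close> =
  \<open>Qbar N \<beta> M (Suc k)\<close> at the successor state \<open>p'\<close>. Replacing
  \<open>Qhat\<close> by \<open>Qtilde\<close> splits off the \<open>Qbar N \<beta> M k\<close>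
  term, and the discarded block \<open>*\<close> is the remainder in \<open>e\<close>. Symmetry of
  \<open>X\<close> merges the cross terms.\<close>

lemma stage_form_convexify:
  assumes "k < N" and X: "transpose (Qbar N \<beta> M (Suc k)) = Qbar N \<beta> M (Suc k)"
    and p': "p' = mA M k *v p + mB M k *v q + mC M k *v e"
  shows "stage_form M k p q e + p' \<bullet> (Qbar N \<beta> M (Suc k) *v p') =
     stage_form (convexify N \<beta> M) k p q e + p \<bullet> (Qbar N \<beta> M k *v p)
     + (mC M k *v e) \<bullet> (Qbar N \<beta> M (Suc k) *v (mC M k *v e))"
proof -
  define X where "X = Qbar N \<beta> M (Suc k)"
  have Qk: "Qbar N \<beta> M k = Qhat M k X - Qtilde \<beta> M k X"
    using \<open>k < N\<close> by (simp add: Qbar.simps[of N \<beta> M k] X_def)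
  have mult: "x \<bullet> ((transpose A ** X ** B) *v y) = (A *v x) \<bullet> (X *v (B *v y))"
    for A :: "real^'n^'a" and B :: "real^'m^'a" and x y
    by (simp add: matrix_vector_mul_assoc[symmetric] inner_vector_matrix_mult) (simp add: inner_commute)
  have sym: "(mB M k *v q) \<bullet> (X *v (mA M k *v p)) = (mA M k *v p) \<bullet> (X *v (mB M k *v q))"
    "(mC M k *v e) \<bullet> (X *v (mA M k *v p)) = (mA M k *v p) \<bullet> (X *v (mC M k *v e))"
    "(mC M k *v e) \<bullet> (X *v (mB M k *v q)) = (mB M k *v q) \<bullet> (X *v (mC M k *v e))"
    using X inner_symmetric_matrix unfolding X_def by blast+
  show ?thesis
    using \<open>k < N\<close> unfolding X_def[symmetric] p'
    by (simp add: stage_form_def convexify_simps X_def[symmetric] Qk Qhat_def Stilde_def Rtilde_def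
        D1tilde_def D2tilde_def matrix_vector_mult_add_rdistrib matrix_vector_mult_diff_rdistrib
        matrix_vector_right_distrib inner_add_left inner_add_right inner_diff_right mult sym)
qed

text \<open>Backward telescoping of the stage identity. It is stated for tails, assuming symmetry
  strictly after \<open>i\<close>, because the positivity proof for \<open>Rtilde\<close> uses it at
  a stage whose own \<open>Qbar\<close> is not yet known to be symmetric.\<close>

lemma objective_convexify:
  assumes "i \<le> N"
    and "\<And>j. i < j \<Longrightarrow> j \<le> N \<Longrightarrow> transpose (Qbar N \<beta> M j) = Qbar N \<beta> M j"
    and "\<And>k. i \<le> k \<Longrightarrow> k < N \<Longrightarrow> p (Suc k) = mA M k *v p k + mB M k *v q k + mC M k *v l k"
  shows "(\<Sum>k=i..<N. stage_form M k (p k) (q k) (l k)) + term_form N M (p N) (l N) =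
     (\<Sum>k=i..<N. stage_form (convexify N \<beta> M) k (p k) (q k) (l k)) + term_form N (convexify N \<beta> M) (p N) (l N)
     + p i \<bullet> (Qbar N \<beta> M i *v p i)
     + (\<Sum>k=i..<N. (mC M k *v l k) \<bullet> (Qbar N \<beta> M (Suc k) *v (mC M k *v l k)))"
  using assms
proof (induction rule: inc_induct)
  case base
  show ?case
    by (simp add: term_form_def convexify_simps Qbar.simps[of N \<beta> M N]
        matrix_vector_mult_diff_rdistrib inner_diff_right)
next
  case (step i)
  have "stage_form M i (p i) (q i) (l i) + p (Suc i) \<bullet> (Qbar N \<beta> M (Suc i) *v p (Suc i)) =
     stage_form (convexify N \<beta> M) i (p i) (q i) (l i) + p i \<bullet> (Qbar N \<beta> M i *v p i)
     + (mC M i *v l i) \<bullet> (Qbar N \<beta> M (Suc i) *v (mC M i *v l i))"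
    using step by (intro stage_form_convexify) auto
  moreover have "(\<Sum>k=Suc i..<N. stage_form M k (p k) (q k) (l k)) + term_form N M (p N) (l N) =
     (\<Sum>k=Suc i..<N. stage_form (convexify N \<beta> M) k (p k) (q k) (l k)) + term_form N (convexify N \<beta> M) (p N) (l N)
     + p (Suc i) \<bullet> (Qbar N \<beta> M (Suc i) *v p (Suc i))
     + (\<Sum>k=Suc i..<N. (mC M k *v l k) \<bullet> (Qbar N \<beta> M (Suc k) *v (mC M k *v l k)))"
    using step by (intro step.IH) auto
  ultimately show ?case
    using \<open>i < N\<close> by (simp add: sum.atLeast_Suc_lessThan)
qed

text \<open>Minimising \<open>q\<close> out of a convexified stage leaves exactly \<open>\<beta> \<bar>p\<bar>\<^sup>2\<close>: this is what
  the choice of \<open>Qtilde\<close> achieves.\<close>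

lemma stage_form_convexify_feedback:
  assumes "k < N" and inv: "invertible (Rtilde M k (Qbar N \<beta> M (Suc k)))"
  shows "stage_form (convexify N \<beta> M) k p
     (- (matrix_inv (Rtilde M k (Qbar N \<beta> M (Suc k))) *v (Stilde M k (Qbar N \<beta> M (Suc k)) *v p))) 0
     = \<beta> * (p \<bullet> p)"
proof -
  define R S where "R = Rtilde M k (Qbar N \<beta> M (Suc k))" and "S = Stilde M k (Qbar N \<beta> M (Suc k))"
  have "R *v (matrix_inv R *v y) = y" for y
    using inv by (simp add: matrix_vector_mul_assoc R_def matrix_inv_inverse)
  then show ?thesis
    using \<open>k < N\<close>
    by (simp add: stage_form_def convexify_simps Qtilde_def mat_vector_mult R_def[symmetric] S_def[symmetric]
        matrix_vector_mult_add_rdistrib matrix_vector_mul_assoc[symmetric] inner_add_right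
        inner_vector_matrix_mult linear_neg[OF matrix_vector_mul_linear] inner_commute)
qed

text \<open>The condition \<open>ReH \<succeq> \<gamma> I\<close>, expressed on trajectories of the homogeneous dynamics.\<close>

definition coercive_lq :: "nat \<Rightarrow> ('x::finite,'u::finite,'d::finite) lq \<Rightarrow> real \<Rightarrow> bool" where
  "coercive_lq N M \<gamma> \<longleftrightarrow> (\<forall>p q. p 0 = 0 \<and> (\<forall>k<N. p (Suc k) = mA M k *v p k + mB M k *v q k) \<longrightarrow>
     \<gamma> * ((\<Sum>k\<le>N. p k \<bullet> p k) + (\<Sum>k<N. q k \<bullet> q k))
       \<le> (\<Sum>k<N. stage_form M k (p k) (q k) 0) + term_form N M (p N) 0)"

section \<open>Positive definiteness of \<open>Rtilde\<close> and symmetry of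
  \<open>Qbar\<close>\<close>

text \<open>Coercivity bounds the cost of the test trajectory below by \<gamma> times its squared
  norm, which includes \<open>v \<bullet> v\<close>. Since \<beta> \<le> \<gamma>, the state terms
  cancel in the right direction and the \<open>Rtilde\<close> form at \<open>v\<close> is at least
  \<open>\<gamma> * (v \<bullet> v)\<close>. The assumptions concern only later stages, as a
  backward induction provides them.\<close>

lemma Rtilde_positive:
  fixes M :: "('x::finite,'u::finite,'d::finite) lq"
  assumes co: "coercive_lq N M \<gamma>" and "0 < \<gamma>" "\<beta> \<le> \<gamma>" "k < N"
    and sym: "\<And>j. k < j \<Longrightarrow> j \<le> N \<Longrightarrow> transpose (Qbar N \<beta> M j) = Qbar N \<beta> M j"
    and inv: "\<And>j. k < j \<Longrightarrow> j < N \<Longrightarrow> invertible (Rtilde M j (Qbar N \<beta> M (Suc j)))"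
    and "v \<noteq> 0"
  shows "v \<bullet> (Rtilde M k (Qbar N \<beta> M (Suc k)) *v v) > 0"
proof -
  define R S where "R j = Rtilde M j (Qbar N \<beta> M (Suc j))" and "S j = Stilde M j (Qbar N \<beta> M (Suc j))" for j
  define fb where "fb j y = (if j < k then 0 else if j = k then v else - (matrix_inv (R j) *v (S j *v y)))" for j y
  \<comment> \<open>The control depends only on the stage and the current state, so the closed loop
    is a plain recursion.\<close>
  define p where "p = rec_nat 0 (\<lambda>j y. mA M j *v y + mB M j *v fb j y)"
  define q where "q j = fb j (p j)" for j
  have p_Suc: "p (Suc j) = mA M j *v p j + mB M j *v q j" and p_0: "p 0 = 0" for j
    by (simp_all add: p_def q_def)
  have p_le: "p j = 0" if "j \<le> k" for j
    using that by (induction j) (simp_all add: p_0 p_Suc q_def fb_def)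
  have q_less: "q j = 0" if "j < k" for j
    using that by (simp add: q_def fb_def)
  have q_k: "q k = v" by (simp add: q_def fb_def)
  have "(\<Sum>j<N. stage_form M j (p j) (q j) 0) = (\<Sum>j=k..<N. stage_form M j (p j) (q j) 0)"
    by (rule sum.mono_neutral_right) (auto simp: p_le q_less stage_form_def)
  \<comment> \<open>The \<open>Qbar\<close> term at stage \<open>k\<close> vanishes because
    \<open>p k = 0\<close>, and the remainder vanishes because the direction \<open>l\<close> is
    zero.\<close>
  then have "(\<Sum>j<N. stage_form M j (p j) (q j) 0) + term_form N M (p N) 0 =
     (\<Sum>j=k..<N. stage_form (convexify N \<beta> M) j (p j) (q j) 0) + term_form N (convexify N \<beta> M) (p N) 0"
    using objective_convexify[of k N \<beta> M p q "\<lambda>_. 0"] sym \<open>k < N\<close> by (simp add: p_Suc p_le)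
  also have "(\<Sum>j=k..<N. stage_form (convexify N \<beta> M) j (p j) (q j) 0) =
     v \<bullet> (R k *v v) + (\<Sum>j=Suc k..<N. stage_form (convexify N \<beta> M) j (p j) (q j) 0)"
    using \<open>k < N\<close> by (simp add: sum.atLeast_Suc_lessThan p_le q_k stage_form_def convexify_simps R_def)
  also have "(\<Sum>j=Suc k..<N. stage_form (convexify N \<beta> M) j (p j) (q j) 0) = (\<Sum>j=Suc k..<N. \<beta> * (p j \<bullet> p j))"
  proof (rule sum.cong)
    fix j assume j: "j \<in> {Suc k..<N}"
    then have "q j = - (matrix_inv (R j) *v (S j *v p j))"
      by (simp add: q_def fb_def)
    then show "stage_form (convexify N \<beta> M) j (p j) (q j) 0 = \<beta> * (p j \<bullet> p j)"
      using stage_form_convexify_feedback[of j N M \<beta> "p j"] inv[of j] j by (simp add: R_def S_def)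
  qed simp
  also have "term_form N (convexify N \<beta> M) (p N) 0 = \<beta> * (p N \<bullet> p N)"
    by (simp add: term_form_def convexify_simps mat_vector_mult)
  also have "v \<bullet> (R k *v v) + (\<Sum>j=Suc k..<N. \<beta> * (p j \<bullet> p j)) + \<beta> * (p N \<bullet> p N) =
      v \<bullet> (R k *v v) + \<beta> * (\<Sum>j\<le>N. p j \<bullet> p j)"
  proof -
    have "(\<Sum>j\<le>N. p j \<bullet> p j) = (\<Sum>j=Suc k..<Suc N. p j \<bullet> p j)"
      by (rule sum.mono_neutral_right) (auto simp: p_le not_less_eq_eq)
    then show ?thesis
      using \<open>k < N\<close> by (simp add: sum_distrib_left algebra_simps)
  qed
  finally have "\<gamma> * ((\<Sum>j\<le>N. p j \<bullet> p j) + (\<Sum>j<N. q j \<bullet> q j)) \<le> v \<bullet> (R k *v v) + \<beta> * (\<Sum>j\<le>N. p j \<bullet> p j)"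
    using co[unfolded coercive_lq_def, rule_format, of p q] p_0 p_Suc by simp
  moreover have "\<beta> * (\<Sum>j\<le>N. p j \<bullet> p j) \<le> \<gamma> * (\<Sum>j\<le>N. p j \<bullet> p j)"
    using \<open>\<beta> \<le> \<gamma>\<close> by (intro mult_right_mono sum_nonneg) auto
  moreover have "v \<bullet> v \<le> (\<Sum>j<N. q j \<bullet> q j)"
    using member_le_sum[of k "{..<N}" "\<lambda>j. q j \<bullet> q j"] \<open>k < N\<close> q_k by simp
  then have "\<gamma> * (v \<bullet> v) \<le> \<gamma> * (\<Sum>j<N. q j \<bullet> q j)"
    using \<open>0 < \<gamma>\<close> by simp
  moreover have "\<gamma> * (v \<bullet> v) > 0"
    using \<open>v \<noteq> 0\<close> \<open>0 < \<gamma>\<close> by simp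
  ultimately show ?thesis
    unfolding R_def by (simp add: distrib_left)
qed

text \<open>Backward induction: the facts at later stages make \<open>Rtilde\<close> positive
  definite, hence invertible; then its inverse, \<open>Qtilde\<close> and finally
  \<open>Qbar\<close> are symmetric. The induction carries all later stages, since the test
  trajectory runs to the horizon.\<close>

lemma convexify_regular:
  assumes co: "coercive_lq N M \<gamma>" and "0 < \<gamma>" "\<beta> \<le> \<gamma>"
    and Q: "\<And>k. transpose (mQ M k) = mQ M k"
    and R: "\<And>k. k < N \<Longrightarrow> transpose (mR M k) = mR M k"
  shows transpose_Qbar: "k \<le> N \<Longrightarrow> transpose (Qbar N \<beta> M k) = Qbar N \<beta> M k"
    and transpose_Qtilde: "k < N \<Longrightarrow> transpose (Qtilde \<beta> M k (Qbar N \<beta> M (Suc k))) = Qtilde \<beta> M k (Qbar N \<beta> M (Suc k))"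
proof -
  have Qt: "transpose (Qtilde \<beta> M k X) = Qtilde \<beta> M k X"
    if "k < N" "transpose X = X" "invertible (Rtilde M k X)" for k X
  proof -
    have "transpose (matrix_inv (Rtilde M k X)) = matrix_inv (Rtilde M k X)"
      using that by (intro transpose_matrix_inv) (simp_all add: Rtilde_def transpose_add R transpose_congruence)
    then show ?thesis
      by (simp add: Qtilde_def transpose_add transpose_congruence)
  qed
  have main: "\<forall>j. k \<le> j \<and> j \<le> N \<longrightarrow> transpose (Qbar N \<beta> M j) = Qbar N \<beta> M j \<and>
      (j < N \<longrightarrow> invertible (Rtilde M j (Qbar N \<beta> M (Suc j))))" if "k \<le> N" for k
    using that
  proof (induction rule: inc_induct)
    case base
    show ?case
      by (auto simp: Qbar.simps[of N \<beta> M N] transpose_diff Q dest: order.antisym)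
  next
    case (step k)
    have inv: "invertible (Rtilde M k (Qbar N \<beta> M (Suc k)))"
    proof (rule invertible_if_positive)
      fix v :: "real^'b" assume "v \<noteq> 0"
      then show "v \<bullet> (Rtilde M k (Qbar N \<beta> M (Suc k)) *v v) > 0"
        using step.IH \<open>k < N\<close> by (intro Rtilde_positive[OF co assms(2,3)]) (simp_all add: Suc_le_eq)
    qed
    have X: "transpose (Qbar N \<beta> M (Suc k)) = Qbar N \<beta> M (Suc k)"
      using step by simp
    have "transpose (Qbar N \<beta> M k) = Qbar N \<beta> M k"
      using \<open>k < N\<close> by (simp add: Qbar.simps[of N \<beta> M k] transpose_diff Qhat_def transpose_add Q
          transpose_congruence X Qt inv)
    then show ?case
      using step.IH inv by (metis Suc_leI le_neq_implies_less)
  qed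
  show "transpose (Qbar N \<beta> M k) = Qbar N \<beta> M k" if "k \<le> N"
    using main[OF that] that by blast
  show "transpose (Qtilde \<beta> M k (Qbar N \<beta> M (Suc k))) = Qtilde \<beta> M k (Qbar N \<beta> M (Suc k))" if "k < N"
    using main[of k] main[of "Suc k"] that by (intro Qt) auto
qed

section \<open>Coercivity and uniqueness\<close>

lemma sum_z_idx:
  "(\<Sum>c\<in>z_idx N. f c) =
     (\<Sum>k\<le>N. \<Sum>a\<in>UNIV. f (k, Inl (a :: 'x::finite))) + (\<Sum>k<N. \<Sum>b\<in>UNIV. f (k, Inr (b :: 'u::finite)))"
proof -
  have "(\<Sum>c\<in>z_idx N. f c) = (\<Sum>c\<in>{..N} \<times> range Inl. f c) + (\<Sum>c\<in>{..<N} \<times> range Inr. f c)"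
    unfolding z_idx_def by (rule sum.union_disjoint) auto
  moreover have "(\<Sum>c\<in>K \<times> J. f c) = (\<Sum>k\<in>K. \<Sum>j\<in>J. f (k, j))" for K J
    by (simp add: sum.cartesian_product)
  ultimately show ?thesis
    by (simp add: sum.reindex)
qed

lemma sum_quadratic_form_change_basis:
  fixes Z :: "'c \<Rightarrow> 's \<Rightarrow> real"
  shows "(\<Sum>a\<in>J. \<Sum>b\<in>J. (\<Sum>s\<in>I. Z a s * v s) * H a b * (\<Sum>t\<in>I. Z b t * v t)) =
     (\<Sum>s\<in>I. \<Sum>t\<in>I. v s * (\<Sum>a\<in>J. \<Sum>b\<in>J. Z a s * H a b * Z b t) * v t)"
proof -
  have "(\<Sum>a\<in>J. \<Sum>b\<in>J. (\<Sum>s\<in>I. Z a s * v s) * H a b * (\<Sum>t\<in>I. Z b t * v t)) =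
      (\<Sum>a\<in>J. \<Sum>b\<in>J. \<Sum>s\<in>I. \<Sum>t\<in>I. v s * (Z a s * H a b * Z b t) * v t)"
    by (simp add: sum_distrib_left sum_distrib_right mult_ac)
  also have "\<dots> = (\<Sum>a\<in>J. \<Sum>s\<in>I. \<Sum>b\<in>J. \<Sum>t\<in>I. v s * (Z a s * H a b * Z b t) * v t)"
    by (rule sum.cong[OF refl], rule sum.swap)
  also have "\<dots> = (\<Sum>s\<in>I. \<Sum>a\<in>J. \<Sum>b\<in>J. \<Sum>t\<in>I. v s * (Z a s * H a b * Z b t) * v t)"
    by (rule sum.swap)
  also have "\<dots> = (\<Sum>s\<in>I. \<Sum>a\<in>J. \<Sum>t\<in>I. \<Sum>b\<in>J. v s * (Z a s * H a b * Z b t) * v t)"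
    by (rule sum.cong[OF refl], rule sum.cong[OF refl], rule sum.swap)
  also have "\<dots> = (\<Sum>s\<in>I. \<Sum>t\<in>I. \<Sum>a\<in>J. \<Sum>b\<in>J. v s * (Z a s * H a b * Z b t) * v t)"
    by (rule sum.cong[OF refl], rule sum.swap)
  also have "\<dots> = (\<Sum>s\<in>I. \<Sum>t\<in>I. v s * (\<Sum>a\<in>J. \<Sum>b\<in>J. Z a s * H a b * Z b t) * v t)"
    by (simp add: sum_distrib_left sum_distrib_right)
  finally show ?thesis .
qed

lemma finite_z_idx: "finite (z_idx N)"
  by (simp add: z_idx_def)

definition stack :: "(nat \<Rightarrow> real^'x) \<Rightarrow> (nat \<Rightarrow> real^'u) \<Rightarrow> nat \<times> ('x + 'u) \<Rightarrow> real" where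
  "stack p q = (\<lambda>(k, j). case j of Inl a \<Rightarrow> p k $ a | Inr b \<Rightarrow> q k $ b)"

lemma con_jacobian_stack:
  fixes M :: "('x::finite,'u::finite,'d::finite) lq"
  assumes "p 0 = 0" and dyn: "\<And>k. k < N \<Longrightarrow> p (Suc k) = mA M k *v p k + mB M k *v q k"
    and r: "r \<in> con_idx N"
  shows "(\<Sum>c\<in>z_idx N. con_jacobian M r c * stack p q c) = 0"
proof -
  obtain i a where ia: "r = (i, a)" "i \<le> N"
    using r by (auto simp: con_idx_def)
  \<comment> \<open>The state block of stage \<open>k\<close> enters row \<open>i\<close> as the
    identity when \<open>k = i\<close> and as \<open>- mA M k\<close> when
    \<open>Suc k = i\<close>.\<close>
  have x: "(\<Sum>b\<in>UNIV. con_jacobian M (i, a) (k, Inl b) * stack p q (k, Inl b)) =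
     (if k = i then p k $ a else 0) - (if Suc k = i then (mA M k *v p k) $ a else 0)" for k
    by (cases "i = k") (simp_all add: con_jacobian_def stack_def matrix_vector_mult_def sum_negf
        if_distrib[of "\<lambda>c. c * _"] cong: if_cong)
  have u: "(\<Sum>b\<in>UNIV. con_jacobian M (i, a) (k, Inr b) * stack p q (k, Inr b)) =
     - (if Suc k = i then (mB M k *v q k) $ a else 0)" for k
    by (cases "i = k") (simp_all add: con_jacobian_def stack_def matrix_vector_mult_def sum_negf)
  have "(\<Sum>c\<in>z_idx N. con_jacobian M r c * stack p q c) =
     p i $ a - (\<Sum>k\<le>N. if Suc k = i then (mA M k *v p k) $ a else 0)
     - (\<Sum>k<N. if Suc k = i then (mB M k *v q k) $ a else 0)"
    using ia by (simp add: sum_z_idx x u sum_subtractf sum_negf)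
  also have "\<dots> = 0"
  proof (cases i)
    case 0
    then show ?thesis using \<open>p 0 = 0\<close> by simp
  next
    case (Suc j)
    then show ?thesis using dyn[of j] ia by simp
  qed
  finally show ?thesis .
qed

lemma full_hessian_stack:
  fixes M :: "('x::finite,'u::finite,'d::finite) lq"
  shows "(\<Sum>a\<in>z_idx N. \<Sum>b\<in>z_idx N. stack p q a * full_hessian M a b * stack p q b) =
     (\<Sum>k<N. stage_form M k (p k) (q k) 0) + term_form N M (p N) 0"
proof -
  \<comment> \<open>\<open>z_idx N\<close> contains no control at stage \<open>N\<close>, so the
    control columns drop out of the terminal rows.\<close>
  have row: "(\<Sum>b\<in>z_idx N. full_hessian M (k, i) b * stack p q b) =
     (\<Sum>b\<in>UNIV. stage_hessian M k $ i $ Inl b * p k $ b)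
      + (if k < N then (\<Sum>b\<in>UNIV. stage_hessian M k $ i $ Inr b * q k $ b) else 0)"
    if "k \<le> N" for k and i :: "'x + 'u"
  proof -
    have "(\<Sum>b\<in>UNIV. full_hessian M (k, i) (k', Inl b) * stack p q (k', Inl b)) =
       (if k = k' then (\<Sum>b\<in>UNIV. stage_hessian M k $ i $ Inl b * p k $ b) else 0)"
      "(\<Sum>b\<in>UNIV. full_hessian M (k, i) (k', Inr b) * stack p q (k', Inr b)) =
       (if k = k' then (\<Sum>b\<in>UNIV. stage_hessian M k $ i $ Inr b * q k $ b) else 0)" for k'
      by (simp_all add: full_hessian_def stack_def)
    then show ?thesis
      using that by (simp add: sum_z_idx)
  qed
  have rowl: "(\<Sum>b\<in>z_idx N. full_hessian M (k, Inl a) b * stack p q b) =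
     (mQ M k *v p k + (if k < N then transpose (mS M k) *v q k else 0)) $ a" if "k \<le> N" for k a
    unfolding row[OF that]
    by (simp add: stage_hessian_def matrix_vector_mult_def vector_matrix_mult_def transpose_def mult.commute)
  have rowr: "(\<Sum>b\<in>z_idx N. full_hessian M (k, Inr a) b * stack p q b) =
     (mS M k *v p k + mR M k *v q k) $ a" if "k < N" for k a
    using that by (simp add: row stage_hessian_def matrix_vector_mult_def)
  have "(\<Sum>a\<in>z_idx N. \<Sum>b\<in>z_idx N. stack p q a * full_hessian M a b * stack p q b) =
     (\<Sum>a\<in>z_idx N. stack p q a * (\<Sum>b\<in>z_idx N. full_hessian M a b * stack p q b))"
    by (simp add: sum_distrib_left mult.assoc)
  also have "\<dots> = (\<Sum>k\<le>N. p k \<bullet> (mQ M k *v p k + (if k < N then transpose (mS M k) *v q k else 0)))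
      + (\<Sum>k<N. q k \<bullet> (mS M k *v p k + mR M k *v q k))"
    by (subst sum_z_idx, unfold inner_vec_def, intro arg_cong2[where f = "(+)"] sum.cong refl) (simp_all only: rowl rowr atMost_iff lessThan_iff, simp_all add: stack_def)
  also have "\<dots> = (\<Sum>k<N. stage_form M k (p k) (q k) 0) + term_form N M (p N) 0"
    by (simp add: lessThan_Suc_atMost[symmetric] term_form_def)
      (simp add: stage_form_def inner_add_right inner_vector_matrix_mult sum.distrib[symmetric] algebra_simps)
  finally show ?thesis .
qed

text \<open>A homogeneous trajectory starting at 0 lies in the kernel of the constraint Jacobian, so
  it has coordinates \<open>v\<close> in the columns of \<open>Z\<close>; orthonormality makes its
  squared norm that of \<open>v\<close>.\<close>

lemma coercive_lqI:
  fixes M :: "('x::finite,'u::finite,'d::finite) lq"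
  assumes basis: "orthonormal_kernel_basis (con_idx N) (z_idx N) (con_jacobian M) m Z"
    and ge: "loewner_ge m (reduced_hessian N M Z) \<gamma>"
  shows "coercive_lq N M \<gamma>"
  unfolding coercive_lq_def
proof (intro allI impI, elim conjE)
  fix p :: "nat \<Rightarrow> real^'x" and q :: "nat \<Rightarrow> real^'u"
  assume "p 0 = 0" "\<forall>k<N. p (Suc k) = mA M k *v p k + mB M k *v q k"
  then have "\<forall>r\<in>con_idx N. (\<Sum>c\<in>z_idx N. con_jacobian M r c * stack p q c) = 0"
    by (intro ballI con_jacobian_stack) auto
  then obtain v where v: "\<And>c. c \<in> z_idx N \<Longrightarrow> stack p q c = (\<Sum>s<m. Z c s * v s)"
    using basis unfolding orthonormal_kernel_basis_def by blast
  have orth: "\<And>s t. s < m \<Longrightarrow> t < m \<Longrightarrow> (\<Sum>c\<in>z_idx N. Z c s * Z c t) = (if s = t then 1 else 0)"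
    using basis unfolding orthonormal_kernel_basis_def by blast
  \<comment> \<open>Used for two choices of \<open>H\<close>: the identity, for the norm, and the
    full Hessian, for the cost.\<close>
  have expand: "(\<Sum>a\<in>z_idx N. \<Sum>b\<in>z_idx N. stack p q a * H a b * stack p q b) =
     (\<Sum>s<m. \<Sum>t<m. v s * (\<Sum>a\<in>z_idx N. \<Sum>b\<in>z_idx N. Z a s * H a b * Z b t) * v t)" for H
    by (simp add: v sum_quadratic_form_change_basis[symmetric])
  have "(\<Sum>k\<le>N. p k \<bullet> p k) + (\<Sum>k<N. q k \<bullet> q k) = (\<Sum>a\<in>z_idx N. stack p q a * stack p q a)"
    by (simp add: sum_z_idx stack_def inner_vec_def)
  also have "\<dots> = (\<Sum>a\<in>z_idx N. \<Sum>b\<in>z_idx N. stack p q a * (if a = b then 1 else 0) * stack p q b)"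
    by (simp add: finite_z_idx if_distrib[of "\<lambda>c. _ * c * _"] cong: if_cong)
  also have "\<dots> = (\<Sum>s<m. \<Sum>t<m. v s * (if s = t then 1 else 0) * v t)"
    unfolding expand
    by (simp add: finite_z_idx if_distrib[of "\<lambda>c. _ * c * _"] orth cong: if_cong)
  also have "\<dots> = (\<Sum>s<m. (v s)\<^sup>2)"
    by (simp add: if_distrib[of "\<lambda>c. _ * c * _"] power2_eq_square cong: if_cong)
  finally have "\<gamma> * ((\<Sum>k\<le>N. p k \<bullet> p k) + (\<Sum>k<N. q k \<bullet> q k)) = \<gamma> * (\<Sum>s<m. (v s)\<^sup>2)"
    by simp
  also have "\<dots> \<le> (\<Sum>s<m. \<Sum>t<m. v s * reduced_hessian N M Z s t * v t)"
    using ge unfolding loewner_ge_def by blast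
  also have "\<dots> = (\<Sum>k<N. stage_form M k (p k) (q k) 0) + term_form N M (p N) 0"
    unfolding reduced_hessian_def expand[symmetric] by (rule full_hessian_stack)
  finally show "\<gamma> * ((\<Sum>k\<le>N. p k \<bullet> p k) + (\<Sum>k<N. q k \<bullet> q k))
     \<le> (\<Sum>k<N. stage_form M k (p k) (q k) 0) + term_form N M (p N) 0" .
qed

section \<open>Uniqueness of the minimizer\<close>

text \<open>The terms containing \<open>e\<close> are linear in \<open>(p, q)\<close>, so they
  balance against the midpoint and only the homogeneous form of the difference is left.\<close>

lemma stage_form_parallelogram:
  "stage_form M k p q e + stage_form M k p' q' e =
     2 * stage_form M k ((1/2) *\<^sub>R (p + p')) ((1/2) *\<^sub>R (q + q')) e + (1/2) * stage_form M k (p - p') (q - q') 0"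
  by (simp add: stage_form_def matrix_vector_mult_scaleR matrix_vector_right_distrib
      matrix_vector_mult_diff_distrib inner_add_left inner_add_right inner_diff_left inner_diff_right field_simps)

lemma term_form_parallelogram:
  "term_form N M p e + term_form N M p' e =
     2 * term_form N M ((1/2) *\<^sub>R (p + p')) e + (1/2) * term_form N M (p - p') 0"
  by (simp add: term_form_def matrix_vector_mult_scaleR matrix_vector_right_distrib
      matrix_vector_mult_diff_distrib inner_add_left inner_add_right inner_diff_left inner_diff_right field_simps)

text \<open>The midpoint of two minimizers is feasible and cannot be cheaper than either, so the
  parallelogram identity makes the form of their difference nonpositive; coercivity then forces the
  difference to vanish.\<close>

lemma lqp_minimizer_unique:
  assumes co: "coercive_lq N M \<gamma>" and "0 < \<gamma>"
    and feas: "lqp_feasible N M linit l p q" "lqp_feasible N M linit l p' q'"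
    and min: "\<And>r s. lqp_feasible N M linit l r s \<Longrightarrow> lqp_objective N M l p q \<le> lqp_objective N M l r s"
    and min': "\<And>r s. lqp_feasible N M linit l r s \<Longrightarrow> lqp_objective N M l p' q' \<le> lqp_objective N M l r s"
  shows "(\<forall>k\<le>N. p k = p' k) \<and> (\<forall>k<N. q k = q' k)"
proof -
  define r s where "r k = (1/2) *\<^sub>R (p k + p' k)" and "s k = (1/2) *\<^sub>R (q k + q' k)" for k
  have half: "(1/2) *\<^sub>R (y + y) = y" for y :: "real^'z"
    by (simp add: scaleR_2[symmetric])
  have "lqp_feasible N M linit l r s"
    using feas unfolding lqp_feasible_def
    by (auto simp: r_def s_def half matrix_vector_mult_scaleR matrix_vector_right_distrib
        scaleR_add_right[symmetric]) (simp add: vec_eq_iff)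
  then have "lqp_objective N M l p q + lqp_objective N M l p' q' \<le> 2 * lqp_objective N M l r s"
    using min min' by (smt (verit, best))
  moreover have "lqp_objective N M l p q + lqp_objective N M l p' q' = 2 * lqp_objective N M l r s
     + (1/2) * ((\<Sum>k<N. stage_form M k (p k - p' k) (q k - q' k) 0) + term_form N M (p N - p' N) 0)"
  proof -
    have "(\<Sum>k<N. stage_form M k (p k) (q k) (l k)) + (\<Sum>k<N. stage_form M k (p' k) (q' k) (l k)) =
       2 * (\<Sum>k<N. stage_form M k (r k) (s k) (l k)) + (1/2) * (\<Sum>k<N. stage_form M k (p k - p' k) (q k - q' k) 0)"
      unfolding sum.distrib[symmetric] sum_distrib_left r_def s_def
      by (rule sum.cong[OF refl stage_form_parallelogram])
    then show ?thesis
      using term_form_parallelogram[of N M "p N" "l N" "p' N"]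
      unfolding lqp_objective_eq r_def by argo
  qed
  moreover have "\<gamma> * ((\<Sum>k\<le>N. (p k - p' k) \<bullet> (p k - p' k)) + (\<Sum>k<N. (q k - q' k) \<bullet> (q k - q' k)))
      \<le> (\<Sum>k<N. stage_form M k (p k - p' k) (q k - q' k) 0) + term_form N M (p N - p' N) 0"
    \<comment> \<open>The initial value and the \<open>mC\<close> terms cancel, so the difference is
      a homogeneous trajectory starting at 0.\<close>
    using feas
    by (intro co[unfolded coercive_lq_def, rule_format, of "\<lambda>k. p k - p' k" "\<lambda>k. q k - q' k"])
      (auto simp: lqp_feasible_def matrix_vector_mult_diff_distrib)
  moreover have "x \<le> 0" if "a \<le> 2 * b" "a = 2 * b + (1/2) * y" "x \<le> y" for a b x y :: real
    using that by linarith
  ultimately have "\<gamma> * ((\<Sum>k\<le>N. (p k - p' k) \<bullet> (p k - p' k)) + (\<Sum>k<N. (q k - q' k) \<bullet> (q k - q' k))) \<le> 0"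
    by blast
  then have "(\<Sum>k\<le>N. (p k - p' k) \<bullet> (p k - p' k)) + (\<Sum>k<N. (q k - q' k) \<bullet> (q k - q' k)) \<le> 0"
    using \<open>0 < \<gamma>\<close> by (simp add: mult_le_0_iff)
  moreover have "0 \<le> (\<Sum>k\<le>N. (p k - p' k) \<bullet> (p k - p' k))" "0 \<le> (\<Sum>k<N. (q k - q' k) \<bullet> (q k - q' k))"
    by (auto intro: sum_nonneg)
  ultimately have "(\<Sum>k\<le>N. (p k - p' k) \<bullet> (p k - p' k)) = 0" "(\<Sum>k<N. (q k - q' k) \<bullet> (q k - q' k)) = 0"
    by linarith+
  then show ?thesis
    by (simp add: sum_nonneg_eq_0_iff)
qed

section \<open>Costates\<close>

text \<open>An index shift in the multiplier sum collects each \<open>p k\<close> in a single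
  summand, so that stationarity in \<open>p k\<close> concerns one stage only.\<close>

lemma lqp_lagrangian_stagewise:
  "lqp_lagrangian N M linit l p q \<zeta> =
     (\<Sum>k<N. stage_form M k (p k) (q k) (l k) + \<zeta> k \<bullet> p k
        - \<zeta> (Suc k) \<bullet> (mA M k *v p k + mB M k *v q k + mC M k *v l k))
     + (term_form N M (p N) (l N) + \<zeta> N \<bullet> p N) - \<zeta> 0 \<bullet> linit"
proof -
  have "(\<Sum>k<N. \<zeta> (Suc k) \<bullet> p (Suc k)) + \<zeta> 0 \<bullet> p 0 = (\<Sum>k<N. \<zeta> k \<bullet> p k) + \<zeta> N \<bullet> p N"
    using sum.lessThan_Suc_shift[of "\<lambda>k. \<zeta> k \<bullet> p k" N] by (simp add: add.commute)
  then show ?thesis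
    unfolding lqp_lagrangian_def lqp_objective_eq
    by (simp add: sum.distrib sum_subtractf inner_diff_right inner_add_right)
qed

lemma GDERIV_unique:
  fixes f :: "real^'n \<Rightarrow> real"
  assumes "GDERIV f x :> D" "GDERIV f x :> E"
  shows "D = E"
  using gradient_eq[OF assms(1)] gradient_eq[OF assms(2)] by simp

text \<open>Stationarity in \<open>p k\<close> solved for the multiplier: an adjoint recursion
  running backward in time. The factor 2 appears because the objective carries no factor
  1/2.\<close>

lemma lqp_costate:
  assumes "k < N" and sym: "transpose (mQ M k) = mQ M k"
    and stat: "GDERIV (\<lambda>y. lqp_lagrangian N M linit l (p(k := y)) q \<zeta>) (p k) :> 0"
  shows "\<zeta> k = transpose (mA M k) *v \<zeta> (Suc k)
     - 2 *\<^sub>R (mQ M k *v p k + transpose (mS M k) *v q k + transpose (mD1 M k) *v l k)"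
proof -
  define T where "T j y = stage_form M j y (q j) (l j) + \<zeta> j \<bullet> y
     - \<zeta> (Suc j) \<bullet> (mA M j *v y + mB M j *v q j + mC M j *v l j)" for j y
  define c where "c = (\<Sum>j\<in>{..<N}-{k}. T j (p j)) + (term_form N M (p N) (l N) + \<zeta> N \<bullet> p N) - \<zeta> 0 \<bullet> linit"
  define g where "g = 2 *\<^sub>R (mQ M k *v p k + transpose (mS M k) *v q k + transpose (mD1 M k) *v l k)
     + \<zeta> k - transpose (mA M k) *v \<zeta> (Suc k)"
  have "lqp_lagrangian N M linit l (p(k := y)) q \<zeta> = T k y + c" for y
    using \<open>k < N\<close>
    by (simp add: lqp_lagrangian_stagewise T_def[symmetric] c_def sum.remove[of "{..<N}" k])
  moreover have "GDERIV (\<lambda>y. T k y + c) (p k) :> g"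
    unfolding gderiv_def T_def stage_form_def g_def
    by (auto intro!: derivative_eq_intros bounded_linear.has_derivative[OF matrix_vector_mul_bounded_linear]
        simp: inner_add_right inner_diff_right inner_vector_matrix_mult inner_symmetric_matrix[OF sym, of "p k"]
          inner_commute[of _ "\<zeta> k"])
  ultimately have "g = 0"
    using stat by (simp add: GDERIV_unique)
  then show ?thesis
    by (simp add: g_def algebra_simps)
qed

lemma lqp_costate_terminal:
  assumes sym: "transpose (mQ M N) = mQ M N"
    and stat: "GDERIV (\<lambda>y. lqp_lagrangian N M linit l (p(N := y)) q \<zeta>) (p N) :> 0"
  shows "\<zeta> N = - 2 *\<^sub>R (mQ M N *v p N + transpose (mD1 M N) *v l N)"
proof -
  define T where "T y = term_form N M y (l N) + \<zeta> N \<bullet> y" for y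
  define c where "c = (\<Sum>k<N. stage_form M k (p k) (q k) (l k) + \<zeta> k \<bullet> p k
        - \<zeta> (Suc k) \<bullet> (mA M k *v p k + mB M k *v q k + mC M k *v l k)) - \<zeta> 0 \<bullet> linit"
  define g where "g = 2 *\<^sub>R (mQ M N *v p N + transpose (mD1 M N) *v l N) + \<zeta> N"
  have "lqp_lagrangian N M linit l (p(N := y)) q \<zeta> = T y + c" for y
    by (simp add: lqp_lagrangian_stagewise T_def c_def)
  moreover have "GDERIV (\<lambda>y. T y + c) (p N) :> g"
    unfolding gderiv_def T_def term_form_def g_def
    by (auto intro!: derivative_eq_intros bounded_linear.has_derivative[OF matrix_vector_mul_bounded_linear]
        simp: inner_add_right inner_vector_matrix_mult inner_symmetric_matrix[OF sym, of "p N"]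
          inner_commute[of _ "\<zeta> N"])
  ultimately have "g = 0"
    using stat by (simp add: GDERIV_unique)
  then show ?thesis
    by (simp add: g_def eq_neg_iff_add_eq_0 add.commute)
qed

section \<open>Comparison of the original and the convexified problem\<close>

text \<open>The telescoping identity at \<open>i = 0\<close>. The discrepancy depends on
  \<open>linit\<close> and \<open>l\<close> alone, so it is constant on the feasible set.\<close>

lemma lqp_objective_convexify:
  assumes "\<And>j. j \<le> N \<Longrightarrow> transpose (Qbar N \<beta> M j) = Qbar N \<beta> M j"
    and "lqp_feasible N M linit l p q"
  shows "lqp_objective N M l p q = lqp_objective N (convexify N \<beta> M) l p q + linit \<bullet> (Qbar N \<beta> M 0 *v linit)
     + (\<Sum>k<N. (mC M k *v l k) \<bullet> (Qbar N \<beta> M (Suc k) *v (mC M k *v l k)))"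
  using objective_convexify[of 0 N \<beta> M p q l] assms
  by (simp add: lqp_objective_eq lqp_feasible_def atLeast0LessThan)

text \<open>Both adjoint recursions have the same \<open>mA\<close>. The correction at stage
  \<open>Suc k\<close>, pulled back by \<open>transpose (mA M k)\<close> and expanded along the
  dynamics, supplies the increments in \<open>Qhat\<close>, \<open>Stilde\<close> and
  \<open>D1tilde\<close>; what remains is \<open>Qhat - Qtilde\<close>, that is \<open>Qbar\<close>
  at stage \<open>k\<close>.\<close>

lemma costate_convexify:
  fixes M :: "('x::finite,'u::finite,'d::finite) lq"
  assumes Qbar: "\<And>j. j \<le> N \<Longrightarrow> transpose (Qbar N \<beta> M j) = Qbar N \<beta> M j"
    and Q: "\<And>k. transpose (mQ M k) = mQ M k"
    and Qt: "\<And>k. k < N \<Longrightarrow> transpose (Qtilde \<beta> M k (Qbar N \<beta> M (Suc k))) = Qtilde \<beta> M k (Qbar N \<beta> M (Suc k))"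
    and feas: "lqp_feasible N M linit l p q"
    and stat: "\<And>k. k \<le> N \<Longrightarrow> GDERIV (\<lambda>y. lqp_lagrangian N M linit l (p(k := y)) q \<zeta>) (p k) :> 0"
    and pc: "\<And>k. k \<le> N \<Longrightarrow> pc k = p k" and qc: "\<And>k. k < N \<Longrightarrow> qc k = q k"
    and statc: "\<And>k. k \<le> N \<Longrightarrow>
      GDERIV (\<lambda>y. lqp_lagrangian N (convexify N \<beta> M) linit l (pc(k := y)) qc \<zeta>c) (pc k) :> 0"
    and "k \<le> N"
  shows "\<zeta> k = \<zeta>c k - 2 *\<^sub>R (Qbar N \<beta> M k *v p k)"
  using \<open>k \<le> N\<close>
proof (induction rule: inc_induct)
  case base
  have \<zeta>: "\<zeta> N = - 2 *\<^sub>R (mQ M N *v p N + transpose (mD1 M N) *v l N)"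
    by (rule lqp_costate_terminal[OF Q stat]) simp
  have \<zeta>c: "\<zeta>c N = - 2 *\<^sub>R (mat \<beta> *v p N + transpose (mD1 M N) *v l N)"
    using lqp_costate_terminal[OF _ statc] by (simp add: convexify_simps pc)
  show ?case
    unfolding \<zeta> \<zeta>c
    by (simp add: Qbar.simps[of N \<beta> M N] matrix_vector_mult_diff_rdistrib algebra_simps)
next
  case (step k)
  define X where "X = Qbar N \<beta> M (Suc k)"
  have X: "transpose X = X"
    using Qbar[of "Suc k"] \<open>k < N\<close> by (simp add: X_def)
  have Qk: "Qbar N \<beta> M k = Qhat M k X - Qtilde \<beta> M k X"
    using \<open>k < N\<close> by (simp add: Qbar.simps[of N \<beta> M k] X_def)
  have p_Suc: "p (Suc k) = mA M k *v p k + mB M k *v q k + mC M k *v l k"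
    using feas \<open>k < N\<close> by (simp add: lqp_feasible_def)
  have "\<zeta> k = transpose (mA M k) *v \<zeta> (Suc k)
     - 2 *\<^sub>R (mQ M k *v p k + transpose (mS M k) *v q k + transpose (mD1 M k) *v l k)"
    using lqp_costate[OF \<open>k < N\<close> Q stat] \<open>k < N\<close> by simp
  also have "\<zeta> (Suc k) = \<zeta>c (Suc k) - 2 *\<^sub>R (X *v (mA M k *v p k + mB M k *v q k + mC M k *v l k))"
    using step.IH by (simp only: X_def p_Suc)
  finally have \<zeta>: "\<zeta> k = transpose (mA M k) *v (\<zeta>c (Suc k) - 2 *\<^sub>R (X *v (mA M k *v p k + mB M k *v q k + mC M k *v l k)))
     - 2 *\<^sub>R (mQ M k *v p k + transpose (mS M k) *v q k + transpose (mD1 M k) *v l k)" .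
  have \<zeta>c: "\<zeta>c k = transpose (mA M k) *v \<zeta>c (Suc k)
     - 2 *\<^sub>R (Qtilde \<beta> M k X *v p k + transpose (Stilde M k X) *v q k + transpose (D1tilde M k X) *v l k)"
    using lqp_costate[OF \<open>k < N\<close> _ statc] \<open>k < N\<close> by (simp add: convexify_simps pc qc Qt X_def)
  show ?case
    unfolding \<zeta> \<zeta>c Qk
    \<comment> \<open>Products with transposes must stay in matrix form here, so that
      \<open>transpose_congruence\<close> can rewrite the transposed blocks.\<close>
    by (simp del: transpose_matrix_vector add: Qhat_def Stilde_def D1tilde_def transpose_add
        transpose_congruence[OF X] matrix_vector_mult_add_rdistrib matrix_vector_mult_diff_rdistrib
        matrix_vector_right_distrib matrix_vector_mult_diff_distrib matrix_vector_mult_scaleR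
        matrix_vector_mul_assoc[symmetric] algebra_simps)
qed

theorem theorem3:
  fixes N m :: nat
    and P :: "('x::finite, 'u::finite, 'd::finite) ocp"
    and dinit linit :: "real^'x"
    and d l :: "nat \<Rightarrow> real^'d"
    and x lam :: "nat \<Rightarrow> real^'x"
    and u :: "nat \<Rightarrow> real^'u"
    and Z :: "nat \<times> ('x + 'u) \<Rightarrow> nat \<Rightarrow> real"
    and \<gamma> \<beta> :: real
    and M :: "('x, 'u, 'd) lq"
    and p \<zeta> pc \<zeta>c :: "nat \<Rightarrow> real^'x"
    and q qc :: "nat \<Rightarrow> real^'u"
  assumes "N \<ge> 1"
    and "smooth_ocp N P"
    and "ocp_primal_dual_solution N P dinit d x u lam"
    and "M = lq_of N P d x u lam"
    and "orthonormal_kernel_basis (con_idx N) (z_idx N) (con_jacobian M) m Z"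
    and "\<gamma> > 0"
    and "loewner_ge m (reduced_hessian N M Z) \<gamma>"
    and "0 < \<beta>" and "\<beta> < \<gamma>"
    and "lqp_primal_dual_solution N M linit l p q \<zeta>"
    and "lqp_primal_dual_solution N (convexify N \<beta> M) linit l pc qc \<zeta>c"
  shows "(\<forall>k\<le>N. p k = pc k) \<and> (\<forall>k<N. q k = qc k) \<and>
         (\<forall>k\<le>N. \<zeta> k = \<zeta>c k - 2 *\<^sub>R (Qbar N \<beta> M k *v p k))"
proof -
  let ?Mc = "convexify N \<beta> M"
  have Q: "transpose (mQ M k) = mQ M k" for k
    using assms(2,4) by (simp add: transpose_mQ_lq_of)
  have R: "transpose (mR M k) = mR M k" if "k < N" for k
    using assms(2,4) that by (simp add: transpose_mR_lq_of)
  have co: "coercive_lq N M \<gamma>"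
    using assms(5,7) by (rule coercive_lqI)
  have "\<beta> \<le> \<gamma>"
    using assms(9) by simp
  note Qbar = transpose_Qbar[OF co assms(6) this Q R] and Qt = transpose_Qtilde[OF co assms(6) this Q R]
  have feas: "lqp_feasible N M linit l p q" "lqp_feasible N M linit l pc qc"
    and min: "\<And>r s. lqp_feasible N M linit l r s \<Longrightarrow> lqp_objective N M l p q \<le> lqp_objective N M l r s"
    and minc: "\<And>r s. lqp_feasible N M linit l r s \<Longrightarrow> lqp_objective N ?Mc l pc qc \<le> lqp_objective N ?Mc l r s"
    and stat: "\<And>k. k \<le> N \<Longrightarrow> GDERIV (\<lambda>y. lqp_lagrangian N M linit l (p(k := y)) q \<zeta>) (p k) :> 0"
    and statc: "\<And>k. k \<le> N \<Longrightarrow> GDERIV (\<lambda>y. lqp_lagrangian N ?Mc linit l (pc(k := y)) qc \<zeta>c) (pc k) :> 0"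
    using assms(10,11) by (simp_all add: lqp_primal_dual_solution_def lqp_feasible_convexify)
  \<comment> \<open>Both problems have the same feasible set and objectives differing by a constant
    on it, so \<open>pc\<close>, \<open>qc\<close> also minimize the original problem.\<close>
  have "lqp_objective N M l pc qc \<le> lqp_objective N M l r s" if "lqp_feasible N M linit l r s" for r s
    using minc[OF that] lqp_objective_convexify[OF Qbar that] lqp_objective_convexify[OF Qbar feas(2)] by simp
  from lqp_minimizer_unique[OF co assms(6) feas min this]
  have primal: "(\<forall>k\<le>N. p k = pc k) \<and> (\<forall>k<N. q k = qc k)"
    by blast
  moreover have "\<zeta> k = \<zeta>c k - 2 *\<^sub>R (Qbar N \<beta> M k *v p k)" if "k \<le> N" for k
    using primal that by (intro costate_convexify[OF Qbar Q Qt feas(1) stat _ _ statc]) simp_all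
  ultimately show ?thesis
    by blast
qed

end
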